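(* For every $k\ge1$ there are configurations $\mathbf q=(q_1,\dots,q_{2k+3})$ of points in convex position in $\mathbb{R}^2$ such that the rows of $C_{2k}(\mathbf q)$ realize $\overline{\Delta}_k(2k+3)$ as a complete fan. For example, the vertices of a regular $(2k+3)$-gon, in cyclic order, have this property.
   Context: An edge is an element of $\binom{[n]}{2}$. Two disjoint edges $\{i,j\},\{a,b\}$ with $i<j$, $a<b$ cross if $i<a<j<b$ or $a<i<b<j$. The length of $\{i,j\}$ is $\min\{|j-i|,n-|j-i|\}$. $\overline{\Delta}_k(n)$ is the simplicial complex whose vertices are the edges of length at least $k+1$ and whose faces are the sets of such edges containing no $k+1$ pairwise crossing edges; it is a sphere of dimension $k(n-2k-1)-1$. Convex position: $q_1,\dots,q_n$ are the distinct vertices of a convex $n$-gon, in this cyclic order. $C_d(\mathbf q)$ has one row per edge $\{i,j\}$, $i<j$, and one block of $d$ columns per vertex; with $q_i=(x_i,y_i)$, the row of $\{i,j\}$ has $\mathbf c_{ij}$ in block $i$, $-\mathbf c_{ij}$ in block $j$, zeros elsewhere, where $\mathbf c_{ij}=\big((x_i-x_j)^{d-1},(y_i-y_j)(x_i-x_j)^{d-2},\dots,(y_i-y_j)^{d-1}\big)$. Realizing as a complete fan: let $(v_e)_{e\in\binom{[n]}{2}}$ be vectors, $W$ their linear span, $W'$ the quotient of $W$ by the span of the $v_e$ with $e$ of length at most $k$, and $\bar v_e$ the image of $v_e$ in $W'$. The vectors realize $\overline{\Delta}_k(n)$ as a complete fan if $\dim W'=k(n-2k-1)$ and the cones $\operatorname{cone}(\bar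 v_e:e\in F)$, $F\in\overline{\Delta}_k(n)$, form a complete simplicial fan in $W'$ (for each face $F$ the vectors $\{\bar v_e\}_{e\in F}$ are linearly independent; cones of faces $F,G$ intersect exactly in the cone of $F\cap G$; the cones cover $W'$). *)

theory Defs
  imports "HOL-Analysis.Analysis" "HOL-Library.Function_Algebras"
begin

section \<open>The complex of (k+1)-crossing-free sets of edges\<close>

definition edges :: "nat \<Rightarrow> nat set set" where
  "edges n = {e. e \<subseteq> {1..n} \<and> card e = 2}"

definition edge_length :: "nat \<Rightarrow> nat set \<Rightarrow> nat" where
  "edge_length n e = min (Max e - Min e) (n - (Max e - Min e))"

definition crosses :: "nat set \<Rightarrow> nat set \<Rightarrow> bool" where
  "crosses e f \<longleftrightarrow>
     (\<exists>i j a b. e = {i, j} \<and> i < j \<and> f = {a, b} \<and> a < b \<and>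
        (i < a \<and> a < j \<and> j < b \<or> a < i \<and> i < b \<and> b < j))"

definition relevant_edges :: "nat \<Rightarrow> nat \<Rightarrow> nat set set" where
  "relevant_edges k n = {e \<in> edges n. k + 1 \<le> edge_length n e}"

definition irrelevant_edges :: "nat \<Rightarrow> nat \<Rightarrow> nat set set" where
  "irrelevant_edges k n = {e \<in> edges n. edge_length n e \<le> k}"

definition multitriang_complex :: "nat \<Rightarrow> nat \<Rightarrow> nat set set set" where
  "multitriang_complex k n =
     {F. F \<subseteq> relevant_edges k n \<and>
         \<not> (\<exists>X \<subseteq> F. card X = k + 1 \<and> (\<forall>e \<in> X. \<forall>f \<in> X. e \<noteq> f \<longrightarrow> crosses e f))}"


section \<open>Point configurations\<close>

text \<open>
  The extreme points of the hull are exactly the \<open>q i\<close>, and cyclically consecutive ones span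
  its one-dimensional faces; only used for \<open>n \<ge> 3\<close>.
\<close>

definition convex_position :: "nat \<Rightarrow> (nat \<Rightarrow> real \<times> real) \<Rightarrow> bool" where
  "convex_position n q \<longleftrightarrow>
     inj_on q {1..n} \<and>
     {p. p extreme_point_of (convex hull (q ` {1..n}))} = q ` {1..n} \<and>
     (\<forall>i \<in> {1..n}. closed_segment (q i) (q (if i = n then 1 else i + 1))
                      edge_of (convex hull (q ` {1..n})))"

text \<open>
  Centre \<open>c\<close>, circumradius \<open>r\<close>, rotation \<open>\<theta>\<close> are arbitrary; the sign \<open>s\<close> allows both the
  counterclockwise and the clockwise labelling.
\<close>

definition regular_polygon :: "nat \<Rightarrow> (nat \<Rightarrow> real \<times> real) \<Rightarrow> bool" where
  "regular_polygon n q \<longleftrightarrow>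
     (\<exists>c r \<theta> s. 0 < r \<and> s \<in> {1, -1} \<and>
        (\<forall>i \<in> {1..n}. q i = c + r *\<^sub>R (cos (\<theta> + s * 2 * pi * real i / real n),
                                       sin (\<theta> + s * 2 * pi * real i / real n))))"


section \<open>The rows of the cofactor matrix\<close>

instantiation "fun" :: (type, real_vector) real_vector
begin

definition scaleR_fun :: "real \<Rightarrow> ('a \<Rightarrow> 'b) \<Rightarrow> 'a \<Rightarrow> 'b" where
  "scaleR_fun c f = (\<lambda>x. c *\<^sub>R f x)"

instance
  by standard (simp_all add: scaleR_fun_def fun_eq_iff algebra_simps)

end

text \<open>The entry of \<open>c\<^sub>i\<^sub>j\<close> with exponent \<open>t\<close> of the \<open>y\<close>-difference, for \<open>t < d\<close>.\<close>

definition cofactor_entry :: "nat \<Rightarrow> (nat \<Rightarrow> real \<times> real) \<Rightarrow> nat \<Rightarrow> nat \<Rightarrow> nat \<Rightarrow> real" where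
  "cofactor_entry d q i j t = (snd (q i) - snd (q j)) ^ t * (fst (q i) - fst (q j)) ^ (d - 1 - t)"

text \<open>
  A vector with \<open>n\<close> blocks of \<open>d\<close> coordinates is a function on pairs (vertex, position in its
  block) that vanishes outside \<open>{1..n} \<times> {..<d}\<close>.
\<close>

definition cofactor_row :: "nat \<Rightarrow> (nat \<Rightarrow> real \<times> real) \<Rightarrow> nat set \<Rightarrow> (nat \<times> nat \<Rightarrow> real)" where
  "cofactor_row d q e = (\<lambda>(l, t).
     if t < d \<and> l = Min e then cofactor_entry d q (Min e) (Max e) t
     else if t < d \<and> l = Max e then - cofactor_entry d q (Min e) (Max e) t
     else 0)"


section \<open>Quotient vector spaces\<close>

text \<open>
  The quotient of a subspace \<open>W\<close> by a subspace \<open>U \<subseteq> W\<close> is the set of cosets \<open>w + U\<close>, with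
  elementwise addition of sets and zero element \<open>U\<close>.
\<close>

definition quot_space :: "'a::real_vector set \<Rightarrow> 'a set \<Rightarrow> 'a set set" where
  "quot_space W U = (\<lambda>w. w +o U) ` W"

text \<open>Adding \<open>U\<close> makes \<open>0\<close> times a coset equal to \<open>U\<close> instead of \<open>{0}\<close>.\<close>

definition quot_scale :: "'a::real_vector set \<Rightarrow> real \<Rightarrow> 'a set \<Rightarrow> 'a set" where
  "quot_scale U c A = (\<lambda>a. c *\<^sub>R a) ` A + U"

text \<open>
  The sum is taken in the monoid of all sets, whose neutral element is \<open>{0}\<close>; adding \<open>U\<close> only
  matters for the empty combination.
\<close>

definition quot_lincomb ::
    "'a::real_vector set \<Rightarrow> 'e set \<Rightarrow> ('e \<Rightarrow> real) \<Rightarrow> ('e \<Rightarrow> 'a set) \<Rightarrow> 'a set" where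
  "quot_lincomb U F c x = (\<Sum>e\<in>F. quot_scale U (c e) (x e)) + U"

definition quot_independent :: "'a::real_vector set \<Rightarrow> 'e set \<Rightarrow> ('e \<Rightarrow> 'a set) \<Rightarrow> bool" where
  "quot_independent U F x \<longleftrightarrow>
     (\<forall>c. quot_lincomb U F c x = U \<longrightarrow> (\<forall>e\<in>F. c e = 0))"

definition quot_cone :: "'a::real_vector set \<Rightarrow> 'e set \<Rightarrow> ('e \<Rightarrow> 'a set) \<Rightarrow> 'a set set" where
  "quot_cone U F x = {quot_lincomb U F c x | c. \<forall>e\<in>F. 0 \<le> c e}"

definition has_quot_dim :: "'a::real_vector set \<Rightarrow> 'a set \<Rightarrow> nat \<Rightarrow> bool" where
  "has_quot_dim W U m \<longleftrightarrow>
     (\<exists>b :: nat \<Rightarrow> 'a set. (\<forall>i<m. b i \<in> quot_space W U) \<and>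
        quot_independent U {..<m} b \<and>
        (\<forall>A \<in> quot_space W U. \<exists>c. A = quot_lincomb U {..<m} c b))"

lemma coset_add:
  assumes "subspace U"
  shows "(a +o U) + (b +o U) = (a + b) +o U"
proof -
  have "U + U = U"
    using subspace_add[OF assms] subspace_0[OF assms]
    by (force simp: set_plus_def)
  then show ?thesis
    by (simp add: set_plus_rearrange)
qed

lemma quot_scale_coset:
  assumes "subspace U"
  shows "quot_scale U c (a +o U) = (c *\<^sub>R a) +o U"
proof -
  have "c *\<^sub>R (a + u) + v \<in> (c *\<^sub>R a) +o U" if "u \<in> U" "v \<in> U" for u v
    using that subspace_add[OF assms subspace_scale[OF assms that(1), of c] that(2)]
    by (auto simp: elt_set_plus_def scaleR_add_right add.assoc)
  moreover have "c *\<^sub>R a + u \<in> quot_scale U c (a +o U)" if "u \<in> U" for u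
    using that subspace_0[OF assms]
    by (force simp: quot_scale_def set_plus_def elt_set_plus_def)
  ultimately show ?thesis
    by (fastforce simp: quot_scale_def set_plus_def elt_set_plus_def)
qed

lemma quot_lincomb_coset:
  assumes "subspace U" and "finite F"
  shows "quot_lincomb U F c (\<lambda>e. v e +o U) = (\<Sum>e\<in>F. c e *\<^sub>R v e) +o U"
  using assms(2)
proof (induction F rule: finite_induct)
  case empty
  then show ?case by (simp add: quot_lincomb_def)
next
  case (insert e F)
  have "quot_lincomb U (insert e F) c (\<lambda>e. v e +o U)
      = quot_scale U (c e) (v e +o U) + quot_lincomb U F c (\<lambda>e. v e +o U)"
    using insert.hyps by (simp add: quot_lincomb_def add.assoc)
  then show ?case
    using insert by (simp add: quot_scale_coset[OF assms(1)] coset_add[OF assms(1)])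
qed


section \<open>Realizing the complex as a complete fan\<close>

definition realizes_complete_fan :: "nat \<Rightarrow> nat \<Rightarrow> (nat set \<Rightarrow> 'a::real_vector) \<Rightarrow> bool" where
  "realizes_complete_fan k n v \<longleftrightarrow>
     (let W = span (v ` edges n);
          U = span (v ` irrelevant_edges k n);
          W' = quot_space W U;
          vbar = (\<lambda>e. v e +o U);
          \<Delta> = multitriang_complex k n
      in has_quot_dim W U (k * (n - 2 * k - 1)) \<and>
         (\<forall>F \<in> \<Delta>. quot_independent U F vbar) \<and>
         (\<forall>F \<in> \<Delta>. \<forall>G \<in> \<Delta>.
            quot_cone U F vbar \<inter> quot_cone U G vbar = quot_cone U (F \<inter> G) vbar) \<and>
         (\<Union>F \<in> \<Delta>. quot_cone U F vbar) = W')"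

end

theory Submission
  imports Defs
begin

text \<open>
  The relevant edges of the \<open>(2k + 3)\<close>-gon are its \<open>2k + 3\<close> longest diagonals.  They form a star
  polygon, and number \<open>i\<close> joins vertex \<open>i\<close> to vertex \<open>i + k + 1\<close>.  Two of them cross unless they
  share an endpoint, and the families of \<open>k + 1\<close> pairwise crossing ones turn out to be exactly the
  arcs of \<open>k + 1\<close> cyclically consecutive ones.  So a face of the complex is a set of relevant edges
  whose complement meets every such arc.

  The fan is read off from the linear dependences of its rays.  These are the stresses of the point
  configuration, restricted to the relevant edges.  For any \<open>d + 3\<close> points in general position and
  \<open>d\<close> even, the stresses of the complete graph form a three-dimensional space and have the closed
  form \<open>\<omega>\<^sub>i\<^sub>j = [q\<^sub>i q\<^sub>j p] / \<Prod>\<^sub>l [q\<^sub>i q\<^sub>j q\<^sub>l]\<close>.  Here the brackets are \<open>3 \<times> 3\<close> determinants of homogeneous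
  coordinates and \<open>p\<close> is an arbitrary vector in \<open>\<real>\<^sup>3\<close> (lemma \<open>stress_iff_line_form\<close>).  For a regular
  polygon, rotational symmetry makes the denominator the same for all relevant edges.  The numerator
  is the equation of the diagonal, evaluated at \<open>p\<close>.  Hence the dependences among the relevant rows,
  modulo the irrelevant ones, are exactly the functions
  \<open>i \<mapsto> a cos (2\<pi>i/n) + b sin (2\<pi>i/n) + c\<close> with \<open>n = 2k + 3\<close> (lemma \<open>regular_polygon_stress_iff\<close>).

  The rest is Gale duality with these functions (lemma \<open>realizes_complete_fan_if_harmonic\<close>).  A
  nonzero function of this kind with \<open>c \<ge> 0\<close> is positive on an open half circle, which contains
  \<open>k + 1\<close> consecutive vertices because \<open>n\<close> is odd.  So a function that is nonpositive off a face \<open>F\<close>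
  and nonnegative off a face \<open>G\<close> vanishes.  This gives both the independence of the rays of a face
  and the correct intersection of two cones.  For the covering property, a point of the quotient is
  represented by coefficients \<open>\<gamma>\<^sub>i\<close> on the star.  Subtract from them the function below \<open>\<gamma>\<close> with the
  largest constant term.  At this optimum every arc of \<open>k + 1\<close> edges contains one with equality:
  otherwise, since the other \<open>k + 2\<close> indices lie in an open half circle, the constant term could be
  increased.  So the remaining nonnegative coefficients are supported on a face.
\<close>

section \<open>Stresses of planar point configurations\<close>

definition wedge :: "real \<times> real \<Rightarrow> real \<times> real \<Rightarrow> real" where
  "wedge u v = fst u * snd v - snd u * fst v"

text \<open>
  Twice the signed area of the triangle, which is the bracket \<open>[q\<^sub>i q\<^sub>j q\<^sub>l]\<close> of the homogeneous
  coordinates.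
\<close>

definition orient :: "('a \<Rightarrow> real \<times> real) \<Rightarrow> 'a \<Rightarrow> 'a \<Rightarrow> 'a \<Rightarrow> real" where
  "orient q i j l = wedge (q j - q i) (q l - q i)"

text \<open>
  The bracket \<open>[q\<^sub>i q\<^sub>j p]\<close> for a vector \<open>p\<close> of homogeneous coordinates.  As a function of \<open>p\<close> it
  is the equation of the line through \<open>q\<^sub>i\<close> and \<open>q\<^sub>j\<close>.
\<close>

definition line_form ::
    "('a \<Rightarrow> real \<times> real) \<Rightarrow> 'a \<Rightarrow> 'a \<Rightarrow> real \<times> real \<times> real \<Rightarrow> real" where
  "line_form q i j p =
     fst p * (snd (q i) - snd (q j)) + fst (snd p) * (fst (q j) - fst (q i))
       + snd (snd p) * wedge (q i) (q j)"

definition general_position :: "'a set \<Rightarrow> ('a \<Rightarrow> real \<times> real) \<Rightarrow> bool" where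
  "general_position V q \<longleftrightarrow>
     (\<forall>i\<in>V. \<forall>j\<in>V. \<forall>l\<in>V. i \<noteq> j \<and> i \<noteq> l \<and> j \<noteq> l \<longrightarrow> orient q i j l \<noteq> 0)"

text \<open>
  The equilibrium condition at every vertex.  Edges are summed as seen from \<open>i\<close>, which agrees with
  the signed rows of the matrix because the entries have odd degree when \<open>d\<close> is even.
\<close>

definition is_stress :: "nat \<Rightarrow> nat set \<Rightarrow> (nat \<Rightarrow> real \<times> real) \<Rightarrow> (nat set \<Rightarrow> real) \<Rightarrow> bool" where
  "is_stress d V q \<omega> \<longleftrightarrow>
     (\<forall>i\<in>V. \<forall>t<d. (\<Sum>j\<in>V - {i}. \<omega> {i, j} * cofactor_entry d q i j t) = 0)"

text \<open>
  The homogeneous form of the fact that the divided difference of order \<open>m - 1\<close> kills polynomials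
  of degree \<open>m - 2\<close>.  Every linear form on the plane is \<open>wedge a\<close> for some \<open>a\<close>.  In the induction
  one of the forms is written in the basis of two nodes \<open>wedge (v x)\<close> and \<open>wedge (v y)\<close>, and each
  of these cancels a factor of every denominator and removes one node.
\<close>

lemma homogeneous_lagrange:
  fixes v :: "'a \<Rightarrow> real \<times> real"
  assumes "finite S" and "card S = length as + 2"
    and "\<And>j l. j \<in> S \<Longrightarrow> l \<in> S \<Longrightarrow> j \<noteq> l \<Longrightarrow> wedge (v j) (v l) \<noteq> 0"
  shows "(\<Sum>j\<in>S. (\<Prod>a\<leftarrow>as. wedge a (v j)) / (\<Prod>l\<in>S - {j}. wedge (v j) (v l))) = 0"
  using assms
proof (induction as arbitrary: S)
  case Nil
  then have "card S = 2"
    by simp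
  then obtain x y where "S = {x, y}" "x \<noteq> y"
    unfolding card_2_iff by blast
  moreover from this have "{x, y} - {x} = {y}" "{x, y} - {y} = {x}"
    by auto
  moreover have "wedge (v y) (v x) = - wedge (v x) (v y)"
    by (simp add: wedge_def)
  ultimately show ?case
    by simp
next
  case (Cons a as)
  define Q where "Q j = (\<Prod>a\<leftarrow>as. wedge a (v j))" for j
  have drop: "(\<Sum>j\<in>S. wedge (v x) (v j) * Q j / (\<Prod>l\<in>S - {j}. wedge (v j) (v l))) = 0"
    if "x \<in> S" for x
  proof -
    have "(\<Sum>j\<in>S. wedge (v x) (v j) * Q j / (\<Prod>l\<in>S - {j}. wedge (v j) (v l)))
        = (\<Sum>j\<in>S - {x}. wedge (v x) (v j) * Q j / (\<Prod>l\<in>S - {j}. wedge (v j) (v l)))"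
      using \<open>finite S\<close> that by (simp add: sum.remove[of S x] wedge_def)
    also have "\<dots> = (\<Sum>j\<in>S - {x}. - (Q j / (\<Prod>l\<in>(S - {x}) - {j}. wedge (v j) (v l))))"
    proof (intro sum.cong refl)
      fix j
      assume j: "j \<in> S - {x}"
      have "(\<Prod>l\<in>S - {j}. wedge (v j) (v l))
          = wedge (v j) (v x) * (\<Prod>l\<in>(S - {j}) - {x}. wedge (v j) (v l))"
        using \<open>finite S\<close> that j by (intro prod.remove) auto
      moreover have "(S - {j}) - {x} = (S - {x}) - {j}"
        by auto
      moreover have "wedge (v j) (v x) = - wedge (v x) (v j)" "wedge (v x) (v j) \<noteq> 0"
        using Cons.prems(3)[of x j] that j by (auto simp: wedge_def)
      ultimately show "wedge (v x) (v j) * Q j / (\<Prod>l\<in>S - {j}. wedge (v j) (v l))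
          = - (Q j / (\<Prod>l\<in>(S - {x}) - {j}. wedge (v j) (v l)))"
        by simp
    qed
    also have "\<dots> = 0"
      unfolding sum_negf Q_def using Cons.prems that by (subst Cons.IH) auto
    finally show ?thesis .
  qed
  have "2 \<le> card S"
    using Cons.prems(2) by simp
  then obtain T where "T \<subseteq> S" "card T = 2"
    by (rule obtain_subset_with_card_n)
  then obtain x y where xy: "x \<in> S" "y \<in> S" "x \<noteq> y"
    unfolding card_2_iff by blast
  define \<alpha> where "\<alpha> = wedge a (v y) / wedge (v x) (v y)"
  define \<beta> where "\<beta> = - wedge a (v x) / wedge (v x) (v y)"
  have "wedge (v x) (v y) \<noteq> 0"
    using Cons.prems(3) xy by blast
  moreover have "wedge a w * wedge (v x) (v y)
      = wedge a (v y) * wedge (v x) w - wedge a (v x) * wedge (v y) w" for w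
    by (simp add: wedge_def algebra_simps)
  ultimately have ab: "wedge a w = \<alpha> * wedge (v x) w + \<beta> * wedge (v y) w" for w
    by (simp add: \<alpha>_def \<beta>_def field_simps)
  have "(\<Sum>j\<in>S. (\<Prod>a\<leftarrow>a # as. wedge a (v j)) / (\<Prod>l\<in>S - {j}. wedge (v j) (v l)))
      = \<alpha> * (\<Sum>j\<in>S. wedge (v x) (v j) * Q j / (\<Prod>l\<in>S - {j}. wedge (v j) (v l)))
      + \<beta> * (\<Sum>j\<in>S. wedge (v y) (v j) * Q j / (\<Prod>l\<in>S - {j}. wedge (v j) (v l)))"
    by (simp add: ab Q_def sum_distrib_left add_divide_distrib distrib_right mult.assoc
        flip: sum.distrib)
  then show ?case
    using drop xy by simp
qed

text \<open>
  Products of linear forms are combinations of monomials; the exponents \<open>t\<close> and \<open>u\<close> record what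
  has already been multiplied out.
\<close>

lemma linear_products_from_monomials:
  fixes v :: "'a \<Rightarrow> real \<times> real"
  assumes "\<And>t. t \<le> m \<Longrightarrow> (\<Sum>j\<in>S. c j * (snd (v j) ^ t * fst (v j) ^ (m - t))) = 0"
    and "length as + t + u = m"
  shows "(\<Sum>j\<in>S. c j * ((\<Prod>a\<leftarrow>as. wedge a (v j)) * snd (v j) ^ t * fst (v j) ^ u)) = 0"
  using assms(2)
proof (induction as arbitrary: t u)
  case Nil
  then show ?case
    using assms(1)[of t] by (auto simp: mult.assoc)
next
  case (Cons a as)
  have "(\<Sum>j\<in>S. c j * ((\<Prod>a\<leftarrow>a # as. wedge a (v j)) * snd (v j) ^ t * fst (v j) ^ u))
      = fst a * (\<Sum>j\<in>S. c j * ((\<Prod>a\<leftarrow>as. wedge a (v j)) * snd (v j) ^ Suc t * fst (v j) ^ u))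
      - snd a * (\<Sum>j\<in>S. c j * ((\<Prod>a\<leftarrow>as. wedge a (v j)) * snd (v j) ^ t * fst (v j) ^ Suc u))"
    unfolding sum_distrib_left sum_subtractf[symmetric]
    by (intro sum.cong refl) (simp add: wedge_def algebra_simps)
  then show ?case
    using Cons.IH[of "Suc t" u] Cons.IH[of t "Suc u"] Cons.prems by simp
qed

lemma orient_swap: "orient q i l j = - orient q i j l"
  by (simp add: orient_def wedge_def)

lemma orient_swap': "orient q j i l = - orient q i j l"
  by (simp add: orient_def wedge_def algebra_simps)

lemma line_form_antisym: "line_form q j i p = - line_form q i j p"
  by (simp add: line_form_def wedge_def algebra_simps)

text \<open>
  Four vectors in the plane: \<open>line_form q i j p\<close> is a linear form in \<open>q j - q i\<close>, so this is the
  linear relation between the three vectors issuing from \<open>q i\<close>.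
\<close>

lemma line_form_three_term:
  "line_form q i a p * orient q i b c + line_form q i b p * orient q i c a
     + line_form q i c p * orient q i a b = 0"
  by (simp add: line_form_def orient_def wedge_def algebra_simps)

text \<open>
  The stress condition at \<open>i\<close> is tested on the product of the linear forms that vanish in the
  directions from \<open>i\<close> to all vertices except \<open>a\<close>, \<open>b\<close> and \<open>c\<close>.  There are \<open>d - 1\<close> of them, the
  degree of the entries, and only three terms survive.
\<close>

lemma stress_three_term:
  assumes V: "finite V" "card V = d + 3" and st: "is_stress d V q \<omega>" and "0 < d"
    and iabc: "i \<in> V" "a \<in> V" "b \<in> V" "c \<in> V" "distinct [i, a, b, c]"
  defines "\<mu> \<equiv> \<lambda>j. \<omega> {i, j} * (\<Prod>l\<in>V - {i, j}. orient q i j l)"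
  shows "\<mu> a * orient q i b c + \<mu> b * orient q i c a + \<mu> c * orient q i a b = 0"
proof -
  define R where "R = V - {i, a, b, c}"
  define \<Psi> where "\<Psi> j = (\<Prod>l\<in>R. orient q i j l)" for j
  have "finite R"
    using V by (simp add: R_def)
  then obtain ls where ls: "set ls = R" "distinct ls"
    using finite_distinct_list by blast
  have "card R = d - 1"
    using V iabc unfolding R_def by (subst card_Diff_subset) auto
  then have len: "length (map (\<lambda>l. q l - q i) ls) + 0 + 0 = d - 1"
    using ls by (metis add_0_right distinct_card length_map)
  have "(\<Sum>j\<in>V - {i}. \<omega> {i, j} * (snd (q i - q j) ^ t * fst (q i - q j) ^ (d - 1 - t))) = 0"
    if "t \<le> d - 1" for t
    using st iabc(1) that \<open>0 < d\<close> by (auto simp: is_stress_def cofactor_entry_def)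
  from linear_products_from_monomials[OF this len]
  have "0 = (\<Sum>j\<in>V - {i}. \<omega> {i, j} * (\<Prod>a\<leftarrow>map (\<lambda>l. q l - q i) ls. wedge a (q i - q j)))"
    by simp
  also have "\<dots> = (\<Sum>j\<in>V - {i}. \<omega> {i, j} * \<Psi> j)"
  proof (intro sum.cong refl arg_cong2[where f = "(*)"])
    fix j
    have "(\<Prod>a\<leftarrow>map (\<lambda>l. q l - q i) ls. wedge a (q i - q j)) = (\<Prod>l\<leftarrow>ls. orient q i j l)"
      by (auto simp: orient_def wedge_def comp_def algebra_simps)
    also have "\<dots> = \<Psi> j"
      unfolding \<Psi>_def ls(1)[symmetric] using ls(2) by (simp add: prod.distinct_set_conv_list)
    finally show "(\<Prod>a\<leftarrow>map (\<lambda>l. q l - q i) ls. wedge a (q i - q j)) = \<Psi> j" .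
  qed
  also have "\<dots> = (\<Sum>j\<in>{a, b, c}. \<omega> {i, j} * \<Psi> j)"
  proof (intro sum.mono_neutral_right ballI)
    fix j
    assume "j \<in> V - {i} - {a, b, c}"
    then have "j \<in> R" "orient q i j j = 0"
      by (auto simp: R_def orient_def wedge_def)
    then have "\<Psi> j = 0"
      unfolding \<Psi>_def using \<open>finite R\<close> by (intro prod_zero) auto
    then show "\<omega> {i, j} * \<Psi> j = 0"
      by simp
  qed (use V iabc in auto)
  finally have sum0: "\<omega> {i, a} * \<Psi> a + \<omega> {i, b} * \<Psi> b + \<omega> {i, c} * \<Psi> c = 0"
    using iabc by simp
  have split: "(\<Prod>l\<in>insert x (insert y R). orient q i j l) = orient q i j x * orient q i j y * \<Psi> j"
    if "x \<in> {a, b, c}" "y \<in> {a, b, c}" "x \<noteq> y" for j x y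
    using that \<open>finite R\<close> iabc by (auto simp: R_def \<Psi>_def)
  have "V - {i, a} = insert b (insert c R)" "V - {i, b} = insert a (insert c R)"
      "V - {i, c} = insert a (insert b R)"
    using iabc by (auto simp: R_def)
  then have "\<mu> a = \<omega> {i, a} * (orient q i a b * orient q i a c * \<Psi> a)"
      "\<mu> b = \<omega> {i, b} * (orient q i b a * orient q i b c * \<Psi> b)"
      "\<mu> c = \<omega> {i, c} * (orient q i c a * orient q i c b * \<Psi> c)"
    using iabc by (simp_all add: \<mu>_def split)
  then have "\<mu> a * orient q i b c + \<mu> b * orient q i c a + \<mu> c * orient q i a b
      = orient q i a b * orient q i a c * orient q i b c
        * (\<omega> {i, a} * \<Psi> a + \<omega> {i, b} * \<Psi> b + \<omega> {i, c} * \<Psi> c)"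
    by (simp add: orient_swap[of q i a b] orient_swap[of q i a c] orient_swap[of q i b c]
        algebra_simps)
  then show ?thesis
    by (simp add: sum0)
qed

text \<open>
  On three vertices \<open>x, y, z\<close> the values of \<open>\<mu>\<close> can be matched by a suitable \<open>p\<close>, since the lines of
  a triangle are linearly independent.  The three-term relation then propagates the agreement, first
  to all edges that meet the triangle and from there to all edges.
\<close>

lemma three_term_imp_line_form:
  assumes V: "finite V" "3 \<le> card V" and gp: "general_position V q"
    and anti: "\<And>i j. i \<in> V \<Longrightarrow> j \<in> V \<Longrightarrow> i \<noteq> j \<Longrightarrow> \<mu> j i = - \<mu> i j"
    and three: "\<And>i a b c. i \<in> V \<Longrightarrow> a \<in> V \<Longrightarrow> b \<in> V \<Longrightarrow> c \<in> V \<Longrightarrow> distinct [i, a, b, c] \<Longrightarrow>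
        \<mu> i a * orient q i b c + \<mu> i b * orient q i c a + \<mu> i c * orient q i a b = 0"
  obtains p where "\<And>i j. i \<in> V \<Longrightarrow> j \<in> V \<Longrightarrow> i \<noteq> j \<Longrightarrow> \<mu> i j = line_form q i j p"
proof -
  obtain x y z where xyz: "x \<in> V" "y \<in> V" "z \<in> V" "distinct [x, y, z]"
  proof -
    obtain T where "T \<subseteq> V" "card T = 3"
      using V(2) by (rule obtain_subset_with_card_n)
    then show ?thesis
      using that by (auto simp: card_3_iff)
  qed
  have "orient q x y z \<noteq> 0"
    using gp xyz by (auto simp: general_position_def)
  \<comment> \<open>Cramer's rule: \<open>p\<close> is the combination of the three points with these coefficients, and only the
    opposite vertex contributes to the value on a side of the triangle.\<close>
  define \<alpha> \<beta> \<gamma> where "\<alpha> = \<mu> y z / orient q x y z" and "\<beta> = - \<mu> x z / orient q x y z"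
    and "\<gamma> = \<mu> x y / orient q x y z"
  define p where "p = (\<alpha> * fst (q x) + \<beta> * fst (q y) + \<gamma> * fst (q z),
      \<alpha> * snd (q x) + \<beta> * snd (q y) + \<gamma> * snd (q z), \<alpha> + \<beta> + \<gamma>)"
  define \<nu> where "\<nu> i j = \<mu> i j - line_form q i j p" for i j
  have "line_form q x y p = \<gamma> * orient q x y z" "line_form q x z p = - \<beta> * orient q x y z"
      "line_form q y z p = \<alpha> * orient q x y z"
    by (simp_all add: p_def line_form_def orient_def wedge_def algebra_simps)
  then have base: "\<nu> x y = 0" "\<nu> x z = 0" "\<nu> y z = 0"
    using \<open>orient q x y z \<noteq> 0\<close> by (simp_all add: \<nu>_def \<alpha>_def \<beta>_def \<gamma>_def)
  have anti': "\<nu> j i = - \<nu> i j" if "i \<in> V" "j \<in> V" "i \<noteq> j" for i j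
    using anti[OF that] by (simp add: \<nu>_def line_form_antisym[of q j i])
  have three': "\<nu> i a * orient q i b c + \<nu> i b * orient q i c a + \<nu> i c * orient q i a b = 0"
    if "i \<in> V" "a \<in> V" "b \<in> V" "c \<in> V" "distinct [i, a, b, c]" for i a b c
    using three[OF that] line_form_three_term[of q i a p b c]
    by (simp add: \<nu>_def algebra_simps)
  have step: "\<nu> i c = 0"
    if "i \<in> V" "a \<in> V" "b \<in> V" "c \<in> V" "i \<noteq> c" "distinct [i, a, b]" "\<nu> i a = 0" "\<nu> i b = 0"
    for i a b c
  proof (cases "c \<in> {a, b}")
    case False
    then have "\<nu> i c * orient q i a b = 0"
      using three'[of i a b c] that by auto
    moreover have "orient q i a b \<noteq> 0"
      using gp that by (auto simp: general_position_def)
    ultimately show ?thesis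
      by simp
  qed (use that in auto)
  have "\<nu> z x = 0" "\<nu> z y = 0" "\<nu> y x = 0"
    using base anti' xyz by auto
  then have x: "\<nu> x c = 0" if "c \<in> V" "c \<noteq> x" for c
    using step[of x y z c] that xyz base by auto
  have y: "\<nu> y c = 0" if "c \<in> V" "c \<noteq> y" for c
    using step[of y x z c] that xyz base \<open>\<nu> y x = 0\<close> by auto
  have z: "\<nu> z c = 0" if "c \<in> V" "c \<noteq> z" for c
    using step[of z x y c] that xyz \<open>\<nu> z x = 0\<close> \<open>\<nu> z y = 0\<close> by auto
  have "\<nu> i j = 0" if "i \<in> V" "j \<in> V" "i \<noteq> j" for i j
  proof (cases "i \<in> {x, y, z}")
    case True
    then show ?thesis
      using x y z that by auto
  next
    case False
    then have "\<nu> i x = 0" "\<nu> i y = 0"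
      using anti'[of x i] anti'[of y i] x[of i] y[of i] that xyz by auto
    then show ?thesis
      using step[of i x y j] that xyz False by auto
  qed
  then show ?thesis
    using that[of p] by (simp add: \<nu>_def)
qed

text \<open>
  Necessity is the three-term relation.  For sufficiency, the numerator is a linear form in
  \<open>q j - q i\<close>, so the sum at \<open>i\<close> is a Lagrange sum over \<open>d + 2\<close> nodes with a numerator of degree
  \<open>1 + (d - 1)\<close>.
\<close>

lemma stress_iff_line_form:
  assumes V: "finite V" "card V = d + 3" and d: "even d" "0 < d" and gp: "general_position V q"
  shows "is_stress d V q \<omega> \<longleftrightarrow>
    (\<exists>p. \<forall>i\<in>V. \<forall>j\<in>V. i \<noteq> j \<longrightarrow>
        \<omega> {i, j} * (\<Prod>l\<in>V - {i, j}. orient q i j l) = line_form q i j p)"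
    (is "?L \<longleftrightarrow> ?R")
proof
  define \<mu> where "\<mu> i j = \<omega> {i, j} * (\<Prod>l\<in>V - {i, j}. orient q i j l)" for i j
  assume ?L
  have anti: "\<mu> j i = - \<mu> i j" if "i \<in> V" "j \<in> V" "i \<noteq> j" for i j
  proof -
    have "card (V - {i, j}) = d + 1"
      using V that by (subst card_Diff_subset) auto
    then have "odd (card (V - {i, j}))"
      using d by simp
    then have "(\<Prod>l\<in>V - {i, j}. orient q j i l) = - (\<Prod>l\<in>V - {i, j}. orient q i j l)"
      by (simp add: orient_swap'[of q j i] prod_uminus)
    then show ?thesis
      by (simp add: \<mu>_def insert_commute)
  qed
  have three: "\<mu> i a * orient q i b c + \<mu> i b * orient q i c a + \<mu> i c * orient q i a b = 0"
    if "i \<in> V" "a \<in> V" "b \<in> V" "c \<in> V" "distinct [i, a, b, c]" for i a b c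
    unfolding \<mu>_def by (rule stress_three_term[OF V \<open>?L\<close> d(2) that])
  have "3 \<le> card V"
    using V by simp
  from three_term_imp_line_form[OF V(1) this gp anti three]
  obtain p where "\<And>i j. i \<in> V \<Longrightarrow> j \<in> V \<Longrightarrow> i \<noteq> j \<Longrightarrow> \<mu> i j = line_form q i j p"
    by blast
  then show ?R
    unfolding \<mu>_def by blast
next
  assume ?R
  then obtain p where p: "\<And>i j. i \<in> V \<Longrightarrow> j \<in> V \<Longrightarrow> i \<noteq> j \<Longrightarrow>
      \<omega> {i, j} * (\<Prod>l\<in>V - {i, j}. orient q i j l) = line_form q i j p"
    by blast
  show ?L
    unfolding is_stress_def
  proof (intro ballI allI impI)
    fix i t
    assume i: "i \<in> V" and t: "t < d"
    define v where "v j = q j - q i" for j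
    define w where "w = snd (snd p) *\<^sub>R q i - (fst p, fst (snd p))"
    \<comment> \<open>The numerator of the stress, then the coordinates of \<open>q i - q j\<close> as forms in \<open>v j = q j - q i\<close>.\<close>
    define as where "as = w # replicate t (-1, 0) @ replicate (d - 1 - t) (0, 1)"
    have wedge: "wedge (v j) (v l) \<noteq> 0" if "j \<in> V - {i}" "l \<in> V - {i}" "j \<noteq> l" for j l
      using gp that i by (auto simp: general_position_def orient_def v_def)
    have "\<omega> {i, j} * cofactor_entry d q i j t
        = (\<Prod>a\<leftarrow>as. wedge a (v j)) / (\<Prod>l\<in>V - {i} - {j}. wedge (v j) (v l))"
      if j: "j \<in> V - {i}" for j
    proof -
      define \<Psi> where "\<Psi> = (\<Prod>l\<in>V - {i} - {j}. wedge (v j) (v l))"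
      have "V - {i, j} = V - {i} - {j}"
        by auto
      then have "\<omega> {i, j} * \<Psi> = line_form q i j p"
        using p[of i j] i j by (simp add: \<Psi>_def orient_def v_def)
      also have "line_form q i j p = wedge w (v j)"
        by (simp add: line_form_def w_def v_def wedge_def algebra_simps)
      moreover have "\<Psi> \<noteq> 0"
        using V wedge[OF j] by (auto simp: \<Psi>_def)
      ultimately have "\<omega> {i, j} = wedge w (v j) / \<Psi>"
        by (simp add: field_simps)
      moreover have "(\<Prod>a\<leftarrow>as. wedge a (v j)) = wedge w (v j) * cofactor_entry d q i j t"
        by (simp add: as_def cofactor_entry_def prod_list_replicate wedge_def v_def)
      ultimately show ?thesis
        unfolding \<Psi>_def by simp
    qed
    then have "(\<Sum>j\<in>V - {i}. \<omega> {i, j} * cofactor_entry d q i j t)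
        = (\<Sum>j\<in>V - {i}. (\<Prod>a\<leftarrow>as. wedge a (v j)) / (\<Prod>l\<in>V - {i} - {j}. wedge (v j) (v l)))"
      by (rule sum.cong[OF refl])
    also have "\<dots> = 0"
      using V i t wedge by (intro homogeneous_lagrange) (auto simp: as_def)
    finally show "(\<Sum>j\<in>V - {i}. \<omega> {i, j} * cofactor_entry d q i j t) = 0" .
  qed
qed

lemma cofactor_entry_swap:
  assumes "even d" "t < d"
  shows "cofactor_entry d q j i t = - cofactor_entry d q i j t"
proof -
  have "odd (t + (d - 1 - t))"
    using assms by simp
  then have "(-1 :: real) ^ t * (-1) ^ (d - 1 - t) = -1"
    by (simp only: minus_one_power_iff even_add) auto
  moreover have "cofactor_entry d q j i t
      = ((-1) ^ t * (-1) ^ (d - 1 - t)) * cofactor_entry d q i j t"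
    using power_minus[of "snd (q i) - snd (q j)" t]
      power_minus[of "fst (q i) - fst (q j)" "d - 1 - t"]
    by (simp add: cofactor_entry_def)
  ultimately show ?thesis
    by simp
qed

lemma sum_fun_apply: "(\<Sum>e\<in>A. f e) x = (\<Sum>e\<in>A. f e x)" for f :: "'b \<Rightarrow> 'a \<Rightarrow> real"
  by (induction A rule: infinite_finite_induct) auto

lemma finite_edges [simp]: "finite (edges n)"
  by (rule finite_subset[of _ "Pow {1..n}"]) (auto simp: edges_def)

lemma pair_in_edges_iff: "{i, j} \<in> edges n \<longleftrightarrow> i \<in> {1..n} \<and> j \<in> {1..n} \<and> i \<noteq> j"
  by (cases "i = j") (simp_all add: edges_def)

text \<open>
  For even \<open>d\<close> the sign in the second block of a row is the one produced by swapping the end points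
  in \<open>cofactor_entry_swap\<close>, so both blocks have the same form.
\<close>

lemma row_combination_eq_0_iff:
  assumes d: "even d"
  shows "(\<Sum>e\<in>edges n. \<omega> e *\<^sub>R cofactor_row d q e) = 0 \<longleftrightarrow> is_stress d {1..n} q \<omega>"
proof -
  define S where "S = (\<Sum>e\<in>edges n. \<omega> e *\<^sub>R cofactor_row d q e)"
  have S: "S (i, t) = (\<Sum>e\<in>edges n. \<omega> e * cofactor_row d q e (i, t))" for i t
    by (simp add: S_def sum_fun_apply scaleR_fun_def)
  have Min_Max: "Min e \<in> {1..n}" "Max e \<in> {1..n}" "Min e \<in> e" "Max e \<in> e" if "e \<in> edges n" for e
  proof -
    have "e \<subseteq> {1..n}" "finite e" "e \<noteq> {}"
      using that by (auto simp: edges_def intro: finite_subset)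
    then show "Min e \<in> e" "Max e \<in> e" "Min e \<in> {1..n}" "Max e \<in> {1..n}"
      using Min_in Max_in by blast+
  qed
  have outside: "S (i, t) = 0" if "i \<notin> {1..n} \<or> d \<le> t" for i t
    unfolding S using that Min_Max by (intro sum.neutral) (fastforce simp: cofactor_row_def)
  have inside: "S (i, t) = (\<Sum>j\<in>{1..n} - {i}. \<omega> {i, j} * cofactor_entry d q i j t)"
    if i: "i \<in> {1..n}" and t: "t < d" for i t
  proof -
    have "S (i, t) = (\<Sum>e\<in>(\<lambda>j. {i, j}) ` ({1..n} - {i}). \<omega> e * cofactor_row d q e (i, t))"
      unfolding S
    proof (intro sum.mono_neutral_right ballI)
      fix e
      assume e: "e \<in> edges n - (\<lambda>j. {i, j}) ` ({1..n} - {i})"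
      have "i \<notin> e"
      proof
        assume "i \<in> e"
        moreover obtain a b where "e = {a, b}" "a \<noteq> b" "a \<in> {1..n}" "b \<in> {1..n}"
          using e by (auto simp: edges_def card_2_iff)
        ultimately show False
          using e by auto
      qed
      then have "i \<noteq> Min e" "i \<noteq> Max e"
        using Min_Max[of e] e by auto
      then show "\<omega> e * cofactor_row d q e (i, t) = 0"
        by (simp add: cofactor_row_def)
    qed (use i in \<open>auto simp: pair_in_edges_iff\<close>)
    also have "\<dots> = (\<Sum>j\<in>{1..n} - {i}. \<omega> {i, j} * cofactor_row d q {i, j} (i, t))"
      by (subst sum.reindex) (auto simp: inj_on_def doubleton_eq_iff)
    also have "\<dots> = (\<Sum>j\<in>{1..n} - {i}. \<omega> {i, j} * cofactor_entry d q i j t)"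
    proof (intro sum.cong refl arg_cong2[where f = "(*)"])
      fix j
      assume "j \<in> {1..n} - {i}"
      then have "j < i \<or> i < j"
        by auto
      then show "cofactor_row d q {i, j} (i, t) = cofactor_entry d q i j t"
        using t cofactor_entry_swap[OF d t, of q i j]
        by (auto simp: cofactor_row_def max_def min_def)
    qed
    finally show ?thesis .
  qed
  have "S = 0 \<longleftrightarrow> (\<forall>i t. S (i, t) = 0)"
    by (auto simp: fun_eq_iff)
  also have "\<dots> \<longleftrightarrow> (\<forall>i\<in>{1..n}. \<forall>t<d. S (i, t) = 0)"
    using outside not_less by blast
  also have "\<dots> \<longleftrightarrow> is_stress d {1..n} q \<omega>"
    unfolding is_stress_def by (intro ball_cong refl all_cong) (simp add: inside)
  finally show ?thesis
    by (simp add: S_def)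
qed

section \<open>Trigonometric polynomials of degree one on the regular polygon\<close>

text \<open>
  Restrictions of affine functions to the vertices of a regular polygon.  The three coefficients are
  kept as one vector, because the dependences of the fan are parametrized by this vector space.
\<close>

definition harmonic :: "nat \<Rightarrow> real \<times> real \<times> real \<Rightarrow> nat \<Rightarrow> real" where
  "harmonic n p i =
     fst p * cos (2 * pi * real i / real n) + fst (snd p) * sin (2 * pi * real i / real n)
       + snd (snd p)"

lemma harmonic_0 [simp]: "harmonic n 0 i = 0"
  by (simp add: harmonic_def)

lemma harmonic_add: "harmonic n (p + p') i = harmonic n p i + harmonic n p' i"
  by (simp add: harmonic_def algebra_simps)

lemma harmonic_scaleR: "harmonic n (a *\<^sub>R p) i = a * harmonic n p i"
  by (simp add: harmonic_def algebra_simps)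

lemma harmonic_minus: "harmonic n (- p) i = - harmonic n p i"
  by (simp add: harmonic_def)

lemma harmonic_mod:
  assumes "0 < n"
  shows "harmonic n p (i mod n) = harmonic n p i"
proof -
  have "real i = real (i mod n) + real n * real (i div n)"
    by (metis add.commute mult_div_mod_eq of_nat_add of_nat_mult)
  then have *: "2 * pi * real i / real n
               = 2 * pi * real (i mod n) / real n + 2 * real (i div n) * pi"
    using assms by (simp add: field_simps)
  have "cos (2 * pi * real i / real n) = cos (2 * pi * real (i mod n) / real n)"
    unfolding * by (simp add: cos_add)
  moreover have "sin (2 * pi * real i / real n) = sin (2 * pi * real (i mod n) / real n)"
    unfolding * by (simp add: sin_add)
  ultimately show ?thesis
    by (simp add: harmonic_def)
qed

lemma abs_angle_diff:
  assumes "0 < n"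
  shows "\<bar>2 * pi * real i / real n - \<psi>\<bar> = \<bar>real i - real n * \<psi> / (2 * pi)\<bar> * (2 * pi / real n)"
proof -
  have "2 * pi * real i / real n - \<psi> = (real i - real n * \<psi> / (2 * pi)) * (2 * pi / real n)"
    using assms by (simp add: field_simps)
  also have "\<bar>\<dots>\<bar> = \<bar>real i - real n * \<psi> / (2 * pi)\<bar> * \<bar>2 * pi / real n\<bar>"
    by (rule abs_mult)
  finally show ?thesis
    by simp
qed

lemma mod_window:
  fixes n :: nat
  assumes "z mod n + 1 \<le> j" "j \<le> z mod n + m"
  shows "\<exists>i \<in> {z + 1..z + m}. i mod n = j mod n"
proof (intro bexI)
  have z: "z = z mod n + n * (z div n)"
    by simp
  show "(j + n * (z div n)) mod n = j mod n"
    by simp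
  show "j + n * (z div n) \<in> {z + 1..z + m}"
    using assms z unfolding atLeastAtMost_iff by linarith
qed

text \<open>
  Amplitude and phase.  The phase is chosen at least \<open>\<pi>\<close> so that the vertices near the maximum have
  nonnegative indices, also after moving back by a quarter turn.
\<close>

lemma harmonic_polar:
  obtains A \<psi> where "0 \<le> A" "A\<^sup>2 = (fst p)\<^sup>2 + (fst (snd p))\<^sup>2" "pi \<le> \<psi>"
    "\<And>i. harmonic n p i = A * cos (2 * pi * real i / real n - \<psi>) + snd (snd p)"
proof -
  define z where "z = Complex (fst p) (fst (snd p))"
  define \<psi> where "\<psi> = Arg z + 2 * pi"
  have "z = rcis (cmod z) (Arg z)"
    by (simp add: rcis_cmod_Arg)
  then have "Re z = cmod z * cos (Arg z)" "Im z = cmod z * sin (Arg z)"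
    by (metis Re_rcis, metis Im_rcis)
  then have eq: "fst p = cmod z * cos \<psi>" "fst (snd p) = cmod z * sin \<psi>"
    by (simp_all add: z_def \<psi>_def)
  show ?thesis
  proof (rule that[of "cmod z" \<psi>])
    show "(cmod z)\<^sup>2 = (fst p)\<^sup>2 + (fst (snd p))\<^sup>2"
      by (simp add: cmod_power2 z_def)
    have "- pi < Arg z"
      using Arg_bounded by blast
    then show "pi \<le> \<psi>"
      by (simp add: \<psi>_def)
    show "harmonic n p i = cmod z * cos (2 * pi * real i / real n - \<psi>) + snd (snd p)" for i
      unfolding harmonic_def eq by (simp add: cos_diff algebra_simps)
  qed simp
qed

text \<open>
  The function is positive on the open half circle around its phase.  In units of the angle between
  neighbours this is an open interval of length \<open>n / 2 = k + 3 / 2\<close>, so it contains \<open>k + 1\<close>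
  consecutive integers.
\<close>

lemma harmonic_pos_on_arc:
  assumes n: "n = 2 * k + 3" and p: "p \<noteq> 0" "0 \<le> snd (snd p)"
  obtains z where "\<And>i. i \<in> {z + 1..z + k + 1} \<Longrightarrow> 0 < harmonic n p i"
proof -
  obtain A \<psi> where A: "0 \<le> A" "A\<^sup>2 = (fst p)\<^sup>2 + (fst (snd p))\<^sup>2" and \<psi>: "pi \<le> \<psi>"
    and f: "\<And>i. harmonic n p i = A * cos (2 * pi * real i / real n - \<psi>) + snd (snd p)"
    using harmonic_polar by blast
  show ?thesis
  proof (cases "A = 0")
    case True
    then have "fst p = 0" "fst (snd p) = 0"
      using A(2) by (simp_all add: sum_power2_eq_zero_iff)
    then have "snd (snd p) \<noteq> 0"
      using p(1) by (metis prod.collapse zero_prod_def)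
    then show ?thesis
      using that[of 0] True p(2) by (simp add: f)
  next
    case False
    have n0: "0 < real n"
      using n by simp
    define x where "x = real n * \<psi> / (2 * pi)"
    \<comment> \<open>\<open>x\<close> is the position of the maximum in steps of \<open>2\<pi>/n\<close>; positivity holds at distance below \<open>n/4\<close>.\<close>
    define z where "z = nat \<lfloor>x - real n / 4\<rfloor>"
    have "real n * pi \<le> real n * \<psi>"
      using \<psi> n0 by simp
    then have "real n / 2 \<le> x"
      by (simp add: x_def field_simps)
    then have "0 \<le> x - real n / 4"
      using n0 by simp
    then have z: "real z \<le> x - real n / 4" "x - real n / 4 < real z + 1"
      by (simp_all add: z_def)
    show ?thesis
    proof (rule that[of z])
      fix i
      assume i: "i \<in> {z + 1..z + k + 1}"
      then have "real z + 1 \<le> real i" "real i \<le> real z + real k + 1"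
        using of_nat_mono[of "z + 1" i] of_nat_mono[of i "z + k + 1"] by auto
      moreover have "real n = 2 * real k + 3"
        using n by simp
      ultimately have "\<bar>real i - x\<bar> < real n / 4"
        using z unfolding abs_less_iff by linarith
      then have "\<bar>real i - x\<bar> * (2 * pi / real n) < real n / 4 * (2 * pi / real n)"
        using n0 by (intro mult_strict_right_mono) simp_all
      moreover have "real n / 4 * (2 * pi / real n) = pi / 2"
        using n0 by (simp add: field_simps)
      ultimately have "\<bar>2 * pi * real i / real n - \<psi>\<bar> < pi / 2"
        using n0 by (simp only: abs_angle_diff x_def of_nat_0_less_iff)
      then have "0 < cos (2 * pi * real i / real n - \<psi>)"
        unfolding abs_less_iff by (intro cos_gt_zero_pi) linarith+
      then show "0 < harmonic n p i"
        using False A(1) p(2) by (simp add: f add_pos_nonneg)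
    qed
  qed
qed

text \<open>
  Some vertex is within half a step of the phase, where the cosine is at least \<open>1 / 2\<close>.  This bounds
  the coefficients in the optimization problem below.
\<close>

lemma harmonic_large_somewhere:
  assumes n: "3 \<le> n"
  obtains i where "i < n" "sqrt ((fst p)\<^sup>2 + (fst (snd p))\<^sup>2) / 2 + snd (snd p) \<le> harmonic n p i"
proof -
  obtain A \<psi> where A: "0 \<le> A" "A\<^sup>2 = (fst p)\<^sup>2 + (fst (snd p))\<^sup>2" and \<psi>: "pi \<le> \<psi>"
    and f: "\<And>i. harmonic n p i = A * cos (2 * pi * real i / real n - \<psi>) + snd (snd p)"
    using harmonic_polar by blast
  have n0: "0 < real n"
    using n by simp
  define x where "x = real n * \<psi> / (2 * pi)"
  have "0 \<le> x"
    using n0 order_trans[OF pi_ge_zero \<psi>] by (simp add: x_def)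
  define i where "i = nat \<lfloor>x + 1 / 2\<rfloor>"
  have "real i \<le> x + 1 / 2" "x + 1 / 2 < real i + 1"
    using \<open>0 \<le> x\<close> by (simp_all add: i_def)
  then have "\<bar>real i - x\<bar> \<le> 1 / 2"
    unfolding abs_le_iff by linarith
  then have "\<bar>real i - x\<bar> * (2 * pi / real n) \<le> 1 / 2 * (2 * pi / real n)"
    using n0 by (intro mult_right_mono) simp_all
  moreover have "1 / 2 * (2 * pi / real n) \<le> pi / 3"
    using n by (simp add: field_simps)
  ultimately have "\<bar>2 * pi * real i / real n - \<psi>\<bar> \<le> pi / 3"
    using n0 by (simp only: abs_angle_diff x_def of_nat_0_less_iff order_trans)
  then have "cos (pi / 3) \<le> cos \<bar>2 * pi * real i / real n - \<psi>\<bar>"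
    by (intro cos_monotone_0_pi_le) auto
  then have "1 / 2 \<le> cos (2 * pi * real i / real n - \<psi>)"
    by (simp add: cos_60)
  then have "A * (1 / 2) \<le> A * cos (2 * pi * real i / real n - \<psi>)"
    using A(1) by (intro mult_left_mono)
  then have "A / 2 + snd (snd p) \<le> harmonic n p i"
    by (simp add: f)
  moreover have "sqrt ((fst p)\<^sup>2 + (fst (snd p))\<^sup>2) = A"
    using A by (metis real_sqrt_abs abs_of_nonneg)
  ultimately show ?thesis
    using that[of "i mod n"] n0 by (simp add: harmonic_mod)
qed

text \<open>
  The \<open>k + 2\<close> vertices outside an arc of \<open>k + 1\<close> span an angle less than \<open>\<pi>\<close>, so a line separates
  them from the centre.
\<close>

lemma harmonic_nonpos_off_arc:
  assumes n: "n = 2 * k + 3"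
  obtains p where "0 < snd (snd p)" "\<And>i. i \<in> {z + k + 2..z + n} \<Longrightarrow> harmonic n p i \<le> 0"
proof -
  define x where "x = real z + real k + 2 + real (k + 1) / 2"
  define \<psi> where "\<psi> = 2 * pi * x / real n"
  define \<kappa> where "\<kappa> = cos (pi * real (k + 1) / real n)"
  define p where "p = (- cos \<psi> / \<kappa>, - sin \<psi> / \<kappa>, 1 :: real)"
  have n0: "0 < real n"
    using n by simp
  have arc: "pi * real (k + 1) / real n < pi / 2"
    using n by (simp add: field_simps)
  then have "0 < \<kappa>"
    unfolding \<kappa>_def by (intro cos_gt_zero) (use n0 in auto)
  show ?thesis
  proof (rule that[of p])
    show "0 < snd (snd p)"
      by (simp add: p_def)
    fix i
    assume i: "i \<in> {z + k + 2..z + n}"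
    have "real z + real k + 2 \<le> real i" "real i \<le> real z + 2 * real k + 3"
      using i n of_nat_mono[of "z + k + 2" i] of_nat_mono[of i "z + n"] by auto
    then have "\<bar>real i - x\<bar> \<le> real (k + 1) / 2"
      by (simp add: x_def abs_le_iff field_simps)
    then have "\<bar>real i - x\<bar> * (2 * pi / real n) \<le> real (k + 1) / 2 * (2 * pi / real n)"
      using n0 by (intro mult_right_mono) simp_all
    moreover have "real n * \<psi> / (2 * pi) = x"
      using n0 by (simp add: \<psi>_def)
    moreover have "real (k + 1) / 2 * (2 * pi / real n) = pi * real (k + 1) / real n"
      by simp
    ultimately have "\<bar>2 * pi * real i / real n - \<psi>\<bar> \<le> pi * real (k + 1) / real n"
      using n0 by (simp only: abs_angle_diff of_nat_0_less_iff)
    then have "\<kappa> \<le> cos \<bar>2 * pi * real i / real n - \<psi>\<bar>"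
      unfolding \<kappa>_def using arc pi_gt_zero by (intro cos_monotone_0_pi_le) linarith+
    then have "1 \<le> cos (2 * pi * real i / real n - \<psi>) / \<kappa>"
      using \<open>0 < \<kappa>\<close> by simp
    moreover have "harmonic n p i = 1 - cos (2 * pi * real i / real n - \<psi>) / \<kappa>"
      by (simp add: harmonic_def p_def cos_diff add_divide_distrib algebra_simps)
    ultimately show "harmonic n p i \<le> 0"
      by simp
  qed
qed

text \<open>
  One of \<open>p\<close> and \<open>- p\<close> has a nonnegative constant term and would be positive on a whole arc.
\<close>

lemma harmonic_eq_0_if_two_sided:
  assumes n: "n = 2 * k + 3"
    and S: "\<And>z. \<exists>i \<in> {z + 1..z + k + 1}. harmonic n p i \<le> 0"
    and T: "\<And>z. \<exists>i \<in> {z + 1..z + k + 1}. 0 \<le> harmonic n p i"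
  shows "p = 0"
proof (rule ccontr)
  assume p: "p \<noteq> 0"
  show False
  proof (cases "0 \<le> snd (snd p)")
    case True
    then show False
      using harmonic_pos_on_arc[OF n p] S by (metis not_less)
  next
    case False
    then have "- p \<noteq> 0" "0 \<le> snd (snd (- p))"
      using p by auto
    then obtain z where "\<And>i. i \<in> {z + 1..z + k + 1} \<Longrightarrow> 0 < harmonic n (- p) i"
      using harmonic_pos_on_arc[OF n] by blast
    then show False
      using T[of z] by (force simp: harmonic_minus)
  qed
qed

lemma harmonic_eq_0_if_three_zeros:
  assumes n: "n = 2 * k + 3"
    and zeros: "harmonic n p 0 = 0" "harmonic n p (k + 1) = 0" "harmonic n p (k + 2) = 0"
  shows "p = 0"
proof -
  have zero: "harmonic n p i = 0" if "i mod n \<in> {0, k + 1, k + 2}" for i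
    using that zeros harmonic_mod[of n p i] n by auto
  have "\<exists>i \<in> {z + 1..z + k + 1}. i mod n \<in> {0, k + 1, k + 2}" for z
  proof -
    define w where "w = z mod n"
    \<comment> \<open>The first of the three vertices after \<open>w\<close>, where vertex \<open>0\<close> appears as \<open>n\<close>.\<close>
    define j where "j = (if w < k + 1 then k + 1 else if w < k + 2 then k + 2 else n)"
    have "w < n"
      using n by (simp add: w_def)
    have "j mod n \<in> {0, k + 1, k + 2}" "w + 1 \<le> j" "j \<le> w + k + 1"
      using n \<open>w < n\<close> by (auto simp: j_def)
    then show ?thesis
      using mod_window[of z n j "k + 1"] by (metis w_def add.assoc)
  qed
  then show "p = 0"
    using zero by (intro harmonic_eq_0_if_two_sided[OF n]) (metis order_refl)+
qed

text \<open>
  The three vertices \<open>0, k + 1, k + 2\<close> meet every arc, hence evaluation there is injective on a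
  space of dimension three.
\<close>

lemma harmonic_interpolation:
  assumes n: "n = 2 * k + 3"
  obtains p where "harmonic n p 0 = a" "harmonic n p (k + 1) = b" "harmonic n p (k + 2) = c"
proof -
  define \<Phi> where "\<Phi> p = (harmonic n p 0, harmonic n p (k + 1), harmonic n p (k + 2))" for p
  have lin: "linear \<Phi>"
    by (intro linearI) (simp_all add: \<Phi>_def harmonic_add harmonic_scaleR)
  have "p = 0" if "\<Phi> p = 0" for p
    using that harmonic_eq_0_if_three_zeros[OF n, of p] by (simp add: \<Phi>_def zero_prod_def)
  then have "inj \<Phi>"
    by (simp add: linear_injective_0[OF lin])
  then have "surj \<Phi>"
    using linear_injective_imp_surjective[OF lin] by blast
  then obtain p where "\<Phi> p = (a, b, c)"
    by (metis surjD)
  then show ?thesis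
    using that[of p] by (simp add: \<Phi>_def)
qed

text \<open>
  The function with the largest constant term among those below \<open>c\<close>.  If it were strictly below \<open>c\<close>
  on a whole arc, then a small multiple of a function that is nonpositive off the arc and has positive
  constant term could be added.
\<close>

lemma harmonic_optimum:
  assumes n: "n = 2 * k + 3"
  obtains p where "\<And>i. i < n \<Longrightarrow> harmonic n p i \<le> c i"
    "\<And>z. \<exists>i \<in> {z + 1..z + k + 1}. harmonic n p i = c (i mod n)"
proof -
  have n0: "0 < n" "3 \<le> n"
    using n by simp_all
  define M where "M = Max (c ` {..<n})"
  define b where "b = Min (c ` {..<n})"
  have M: "c i \<le> M" and b: "b \<le> c i" if "i < n" for i
    using that by (simp_all add: M_def b_def)
  \<comment> \<open>The lower bound on the constant term makes the feasible set compact and keeps the constant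
    function \<open>b\<close> feasible.\<close>
  define P where "P = {p. (\<forall>i<n. harmonic n p i \<le> c i) \<and> b \<le> snd (snd p)}"
  have "closed P"
    unfolding P_def harmonic_def
    by (intro closed_Collect_conj closed_Collect_all closed_Collect_imp closed_Collect_le
        continuous_intros) simp_all
  moreover have "bounded P"
  proof -
    have "norm p \<le> 2 * (M - b) + 2 * (M - b) + (\<bar>M\<bar> + \<bar>b\<bar>)" if "p \<in> P" for p
    proof -
      define s where "s = sqrt ((fst p)\<^sup>2 + (fst (snd p))\<^sup>2)"
      obtain i where "i < n" "s / 2 + snd (snd p) \<le> harmonic n p i"
        using harmonic_large_somewhere[OF n0(2)] unfolding s_def by blast
      then have s: "s / 2 + snd (snd p) \<le> M" and "b \<le> snd (snd p)"
        using that M[of i] unfolding P_def by fastforce+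
      have "0 \<le> s"
        by (simp add: s_def)
      have "\<bar>fst p\<bar> \<le> s" "\<bar>fst (snd p)\<bar> \<le> s"
        by (simp_all add: s_def real_sqrt_sum_squares_ge1 real_sqrt_sum_squares_ge2
            flip: real_sqrt_abs)
      then have "\<bar>fst p\<bar> \<le> 2 * (M - b)" "\<bar>fst (snd p)\<bar> \<le> 2 * (M - b)"
          "\<bar>snd (snd p)\<bar> \<le> \<bar>M\<bar> + \<bar>b\<bar>"
        using s \<open>b \<le> snd (snd p)\<close> \<open>0 \<le> s\<close> by (argo | linarith)+
      moreover have "norm p \<le> norm (fst p) + (norm (fst (snd p)) + norm (snd (snd p)))"
        using norm_Pair_le[of "fst p" "snd p"] norm_Pair_le[of "fst (snd p)" "snd (snd p)"]
        by simp
      ultimately show ?thesis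
        by simp
    qed
    then show ?thesis
      by (rule boundedI)
  qed
  ultimately have "compact P"
    by (simp add: compact_eq_bounded_closed)
  moreover have "(0, 0, b) \<in> P"
    using b by (simp add: P_def harmonic_def)
  moreover have "continuous_on P (\<lambda>p. snd (snd p))"
    by (intro continuous_intros)
  ultimately obtain p where p: "p \<in> P" and max: "\<And>p'. p' \<in> P \<Longrightarrow> snd (snd p') \<le> snd (snd p)"
    using continuous_attains_sup[of P "\<lambda>p. snd (snd p)"] by blast
  show ?thesis
  proof (rule that[of p])
    show le: "harmonic n p i \<le> c i" if "i < n" for i
      using p that by (simp add: P_def)
    have le': "harmonic n p i \<le> c (i mod n)" for i
      using le[of "i mod n"] n0 by (simp add: harmonic_mod)
    show "\<exists>i \<in> {z + 1..z + k + 1}. harmonic n p i = c (i mod n)" for z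
    proof (rule ccontr)
      assume "\<not> ?thesis"
      then have less: "harmonic n p i < c (i mod n)" if "i \<in> {z + 1..z + k + 1}" for i
        using that le'[of i] by force
      obtain p' where p': "0 < snd (snd p')"
        "\<And>i. i \<in> {z + k + 2..z + n} \<Longrightarrow> harmonic n p' i \<le> 0"
        using harmonic_nonpos_off_arc[OF n] by blast
      have "\<exists>\<epsilon>>0. \<forall>i \<in> {z + 1..z + k + 1}. harmonic n p i + \<epsilon> * harmonic n p' i \<le> c (i mod n)"
      proof -
        have "\<forall>\<^sub>F \<epsilon> in at_right (0 :: real). \<forall>i \<in> {z + 1..z + k + 1}.
            harmonic n p i + \<epsilon> * harmonic n p' i < c (i mod n)"
        proof (intro eventually_ball_finite ballI)
          fix i
          assume "i \<in> {z + 1..z + k + 1}"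
          moreover have "((\<lambda>\<epsilon>. harmonic n p i + \<epsilon> * harmonic n p' i) \<longlongrightarrow>
              harmonic n p i + 0 * harmonic n p' i) (at_right 0)"
            by (intro tendsto_intros)
          ultimately show "\<forall>\<^sub>F \<epsilon> in at_right 0. harmonic n p i + \<epsilon> * harmonic n p' i < c (i mod n)"
            using less by (intro order_tendstoD) auto
        qed simp
        then have "\<forall>\<^sub>F \<epsilon> in at_right (0 :: real). 0 < \<epsilon> \<and> (\<forall>i \<in> {z + 1..z + k + 1}.
            harmonic n p i + \<epsilon> * harmonic n p' i < c (i mod n))"
          by (rule eventually_conj[OF eventually_at_right_less])
        then obtain \<epsilon> where "0 < \<epsilon>"
          "\<forall>i \<in> {z + 1..z + k + 1}. harmonic n p i + \<epsilon> * harmonic n p' i < c (i mod n)"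
          using eventually_happens'[OF trivial_limit_at_right_real] by blast
        then show ?thesis
          by (intro exI[of _ \<epsilon>]) (simp add: less_imp_le)
      qed
      then obtain \<epsilon> where \<epsilon>: "0 < \<epsilon>"
        "\<And>i. i \<in> {z + 1..z + k + 1} \<Longrightarrow> harmonic n p i + \<epsilon> * harmonic n p' i \<le> c (i mod n)"
        by blast
      have "harmonic n (p + \<epsilon> *\<^sub>R p') i \<le> c (i mod n)" if "i \<in> {z + 1..z + n}" for i
      proof (cases "i \<in> {z + 1..z + k + 1}")
        case True
        then show ?thesis
          using \<epsilon>(2) by (simp add: harmonic_add harmonic_scaleR)
      next
        case False
        then have "\<epsilon> * harmonic n p' i \<le> 0"
          using that p'(2)[of i] \<epsilon>(1) by (auto intro!: mult_nonneg_nonpos)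
        then show ?thesis
          using le'[of i] by (simp add: harmonic_add harmonic_scaleR)
      qed
      moreover have "\<exists>j \<in> {z + 1..z + n}. j mod n = i" if "i < n" for i
      proof -
        define w where "w = z mod n"
        define j where "j = (if w < i then i else i + n)"
        have "w < n"
          using n0 by (simp add: w_def)
        then have "j mod n = i" "w + 1 \<le> j" "j \<le> w + n"
          using that by (auto simp: j_def)
        then show ?thesis
          using mod_window[of z n j n] by (simp add: w_def)
      qed
      ultimately have "harmonic n (p + \<epsilon> *\<^sub>R p') i \<le> c i" if "i < n" for i
        using that n0(1) by (metis harmonic_mod)
      moreover have "b \<le> snd (snd (p + \<epsilon> *\<^sub>R p'))"
        using p p'(1) \<epsilon>(1) by (simp add: P_def add_increasing2)
      ultimately have "snd (snd (p + \<epsilon> *\<^sub>R p')) \<le> snd (snd p)"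
        by (intro max) (simp add: P_def)
      then show False
        using p'(1) \<epsilon>(1) by (simp add: mult_le_0_iff)
    qed
  qed
qed

section \<open>The relevant edges as a star polygon\<close>

lemma mod_neq_if_close:
  fixes i j n :: nat
  assumes "i < j" "j < i + n"
  shows "i mod n \<noteq> j mod n"
proof
  assume "i mod n = j mod n"
  then have "n dvd j - i"
    using mod_eq_dvd_iff_nat[of i j n] assms by simp
  then show False
    using assms by (auto dest!: dvd_imp_le)
qed

text \<open>
  Vertices are numbered from 1, so residue \<open>i\<close> stands for vertex \<open>i mod (2k + 3) + 1\<close>.  The edges
  are listed in the cyclic order of their directions and not along the star, so two of them that share
  an endpoint have indices that differ by \<open>k + 1\<close> or \<open>k + 2\<close>.
\<close>

definition star_edge :: "nat \<Rightarrow> nat \<Rightarrow> nat set" where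
  "star_edge k i = {i mod (2 * k + 3) + 1, (i + k + 1) mod (2 * k + 3) + 1}"

lemma star_edge_mod: "star_edge k (i mod (2 * k + 3)) = star_edge k i"
  using mod_add_left_eq[of i "2 * k + 3" "k + 1"] by (simp only: star_edge_def add.assoc mod_mod_trivial)

lemma star_edge_less:
  assumes "i < 2 * k + 3"
  shows "star_edge k i = (if i < k + 2 then {i + 1, i + k + 2} else {i - k - 1, i + 1})"
proof (cases "i < k + 2")
  case False
  have "(i + k + 1) mod (2 * k + 3) = (i + k + 1 - (2 * k + 3)) mod (2 * k + 3)"
    using False by (intro le_mod_geq) simp
  also have "\<dots> = i - k - 2"
    using assms False by simp
  finally show ?thesis
    using assms False by (auto simp: star_edge_def)
qed (use assms in \<open>simp add: star_edge_def\<close>)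

lemma relevant_edge_iff:
  "e \<in> relevant_edges k (2 * k + 3) \<longleftrightarrow>
     (\<exists>a b. e = {a, b} \<and> 1 \<le> a \<and> b \<le> 2 * k + 3 \<and> (b = a + k + 1 \<or> b = a + k + 2))"
proof
  assume e: "e \<in> relevant_edges k (2 * k + 3)"
  then have "card e = 2" "e \<subseteq> {1..2 * k + 3}"
    by (auto simp: relevant_edges_def edges_def)
  then obtain x y where "e = {x, y}" "x \<noteq> y"
    unfolding card_2_iff by blast
  then obtain a b where ab: "e = {a, b}" "a < b"
    by (metis insert_commute nat_neq_iff)
  moreover have "Max e = b" "Min e = a"
    using ab by simp_all
  ultimately have "k + 1 \<le> min (b - a) (2 * k + 3 - (b - a))"
    using e by (simp add: relevant_edges_def edge_length_def)
  then have "b = a + k + 1 \<or> b = a + k + 2"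
    using ab(2) by (auto simp: min_def split: if_splits)
  then show "\<exists>a b. e = {a, b} \<and> 1 \<le> a \<and> b \<le> 2 * k + 3 \<and> (b = a + k + 1 \<or> b = a + k + 2)"
    using ab \<open>e \<subseteq> {1..2 * k + 3}\<close> by (intro exI[of _ a] exI[of _ b]) auto
next
  assume "\<exists>a b. e = {a, b} \<and> 1 \<le> a \<and> b \<le> 2 * k + 3 \<and> (b = a + k + 1 \<or> b = a + k + 2)"
  then obtain a b where ab: "e = {a, b}" "1 \<le> a" "b \<le> 2 * k + 3" "b = a + k + 1 \<or> b = a + k + 2"
    by blast
  moreover have "Max e = b" "Min e = a" "card e = 2"
    using ab by auto
  ultimately show "e \<in> relevant_edges k (2 * k + 3)"
    by (auto simp: relevant_edges_def edges_def edge_length_def)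
qed

lemma star_edge_bij: "bij_betw (star_edge k) {..<2 * k + 3} (relevant_edges k (2 * k + 3))"
proof (rule bij_betwI')
  fix i j
  assume "i \<in> {..<2 * k + 3}" "j \<in> {..<2 * k + 3}"
  then show "star_edge k i = star_edge k j \<longleftrightarrow> i = j"
    by (auto simp: star_edge_less doubleton_eq_iff)
next
  fix i
  assume i: "i \<in> {..<2 * k + 3}"
  show "star_edge k i \<in> relevant_edges k (2 * k + 3)"
  proof (cases "i < k + 2")
    case True
    then show ?thesis
      using i unfolding relevant_edge_iff
      by (intro exI[of _ "i + 1"] exI[of _ "i + k + 2"]) (simp add: star_edge_less)
  next
    case False
    then show ?thesis
      using i unfolding relevant_edge_iff
      by (intro exI[of _ "i - k - 1"] exI[of _ "i + 1"]) (simp add: star_edge_less)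
  qed
next
  fix e
  assume "e \<in> relevant_edges k (2 * k + 3)"
  then obtain a b where ab: "e = {a, b}" "1 \<le> a" "b \<le> 2 * k + 3" "b = a + k + 1 \<or> b = a + k + 2"
    unfolding relevant_edge_iff by blast
  show "\<exists>i \<in> {..<2 * k + 3}. e = star_edge k i"
  proof (cases "b = a + k + 1")
    case True
    then show ?thesis
      using ab by (intro bexI[of _ "a - 1"]) (auto simp: star_edge_less)
  next
    case False
    then show ?thesis
      using ab by (intro bexI[of _ "b - 1"]) (auto simp: star_edge_less)
  qed
qed

lemma star_edge_relevant: "star_edge k i \<in> relevant_edges k (2 * k + 3)"
  using bij_betw_apply[OF star_edge_bij, of "i mod (2 * k + 3)" k] by (simp add: star_edge_mod)

lemma star_edge_eq_iff: "star_edge k i = star_edge k j \<longleftrightarrow> i mod (2 * k + 3) = j mod (2 * k + 3)"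
  using bij_betw_imp_inj_on[OF star_edge_bij, of k]
    inj_on_eq_iff[of "star_edge k" "{..<2 * k + 3}" "i mod (2 * k + 3)" "j mod (2 * k + 3)"]
  by (simp add: star_edge_mod)

lemma crosses_pair_iff:
  assumes "a < b" "c < d"
  shows "crosses {a, b} {c, d} \<longleftrightarrow> a < c \<and> c < b \<and> b < d \<or> c < a \<and> a < d \<and> d < b"
  using assms by (auto simp: crosses_def doubleton_eq_iff)

lemma crosses_sym: "crosses e f \<longleftrightarrow> crosses f e"
  unfolding crosses_def by blast

lemma star_edge_crosses_less:
  assumes "i < j" "j < 2 * k + 3"
  shows "crosses (star_edge k i) (star_edge k j) \<longleftrightarrow> j \<noteq> i + k + 1 \<and> j \<noteq> i + k + 2"
proof -
  consider "i < k + 2" "j < k + 2" | "i < k + 2" "\<not> j < k + 2" | "\<not> i < k + 2" "\<not> j < k + 2"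
    using assms by linarith
  then show ?thesis
  proof cases
    case 1
    then show ?thesis
      using assms by (auto simp: star_edge_less crosses_pair_iff)
  next
    case 2
    then have "star_edge k i = {i + 1, i + k + 2}" "star_edge k j = {j - k - 1, j + 1}"
      using assms by (simp_all add: star_edge_less)
    then show ?thesis
      using 2 assms by (simp add: crosses_pair_iff) linarith
  next
    case 3
    then have "star_edge k i = {i - k - 1, i + 1}" "star_edge k j = {j - k - 1, j + 1}"
      using assms by (simp_all add: star_edge_less)
    then show ?thesis
      using 3 assms by (simp add: crosses_pair_iff) linarith
  qed
qed

lemma star_edge_crosses_iff:
  assumes "i < j" "j < i + (2 * k + 3)"
  shows "crosses (star_edge k i) (star_edge k j) \<longleftrightarrow> j \<noteq> i + k + 1 \<and> j \<noteq> i + k + 2"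
proof -
  define n where "n = 2 * k + 3"
  define r where "r = i mod n"
  define \<delta> where "\<delta> = j - i"
  have r: "r < n"
    by (simp add: r_def n_def)
  have \<delta>: "0 < \<delta>" "\<delta> < n"
    using assms by (auto simp: \<delta>_def n_def)
  have "star_edge k j = star_edge k ((r + \<delta>) mod n)"
    using assms mod_add_left_eq[of i n \<delta>] unfolding star_edge_eq_iff r_def
    by (simp add: \<delta>_def n_def)
  also have "\<dots> = star_edge k (if r + \<delta> < n then r + \<delta> else r + \<delta> - n)"
    using r \<delta> by (simp add: le_mod_geq)
  finally have j: "star_edge k j = star_edge k (if r + \<delta> < n then r + \<delta> else r + \<delta> - n)" .
  have i: "star_edge k i = star_edge k r"
    by (simp add: r_def n_def star_edge_mod)
  have "crosses (star_edge k i) (star_edge k j) \<longleftrightarrow> \<delta> \<noteq> k + 1 \<and> \<delta> \<noteq> k + 2"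
  proof (cases "r + \<delta> < n")
    case True
    then show ?thesis
      using i j \<delta> star_edge_crosses_less[of r "r + \<delta>" k] by (auto simp: n_def)
  next
    case False
    then have "r + \<delta> - n < r"
      using \<delta> by linarith
    with False show ?thesis
      using i j r \<delta> star_edge_crosses_less[of "r + \<delta> - n" r k]
        crosses_sym[of "star_edge k i" "star_edge k j"] by (auto simp: n_def)
  qed
  then show ?thesis
    using assms(1) by (auto simp: \<delta>_def)
qed

text \<open>
  Let \<open>C\<close> be the index set of the family.  It is disjoint from its translate by \<open>- (k + 1)\<close>, and
  together they miss a single residue \<open>z\<close>, since \<open>2 (k + 1) = n - 1\<close>.  Away from \<open>z\<close> exactly one of \<open>i\<close> and
  \<open>i + k + 1\<close> belongs to \<open>C\<close>.  Two such steps move by \<open>- 1\<close> modulo \<open>n\<close>, so \<open>C\<close> is closed under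
  predecessors until \<open>z\<close> interferes.  Starting from \<open>z - 1\<close> this yields \<open>k + 1\<close> consecutive elements.
\<close>

lemma crossing_family_contains_arc:
  assumes X: "X \<subseteq> relevant_edges k (2 * k + 3)" "card X = k + 1"
    and cross: "\<And>e f. e \<in> X \<Longrightarrow> f \<in> X \<Longrightarrow> e \<noteq> f \<Longrightarrow> crosses e f"
  obtains w where "\<And>i. i \<in> {w + 1..w + k + 1} \<Longrightarrow> star_edge k i \<in> X"
proof -
  define n where "n = 2 * k + 3"
  define C where "C i \<longleftrightarrow> star_edge k i \<in> X" for i
  have n0: "0 < n"
    by (simp add: n_def)
  have C_mod: "C (i mod n) \<longleftrightarrow> C i" for i
    by (simp add: C_def n_def star_edge_mod)
  have disj: "\<not> C (i + k + 1)" if "C i" for i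
  proof
    assume "C (i + k + 1)"
    moreover have "star_edge k i \<noteq> star_edge k (i + k + 1)"
      unfolding star_edge_eq_iff by (intro mod_neq_if_close) auto
    ultimately show False
      using that cross[of "star_edge k i" "star_edge k (i + k + 1)"]
        star_edge_crosses_iff[of i "i + k + 1" k] by (auto simp: C_def)
  qed
  define Y where "Y = {i. i < n \<and> C i}"
  define Z where "Z = {i. i < n \<and> C (i + k + 1)}"
  have "X \<subseteq> star_edge k ` {..<n}"
    using X(1) bij_betw_imp_surj_on[OF star_edge_bij, of k] by (simp add: n_def)
  then have "star_edge k ` Y = X"
    unfolding Y_def C_def by blast
  moreover have "inj_on (star_edge k) Y"
    using bij_betw_imp_inj_on[OF star_edge_bij, of k] by (rule inj_on_subset) (auto simp: Y_def n_def)
  ultimately have "card Y = k + 1"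
    using X(2) card_image by metis
  define \<rho> where "\<rho> i = (i + k + 1) mod n" for i
  have "\<rho> i \<noteq> \<rho> j" if "i < j" "j < n" for i j
    unfolding \<rho>_def using that by (intro mod_neq_if_close) auto
  then have \<rho>: "inj_on \<rho> {..<n}"
    by (intro linorder_inj_onI') auto
  moreover have "\<rho> ` {..<n} \<subseteq> {..<n}"
    using n0 by (auto simp: \<rho>_def)
  ultimately have surj: "\<rho> ` {..<n} = {..<n}"
    by (intro endo_inj_surj) auto
  have Z_iff: "i \<in> Z \<longleftrightarrow> i < n \<and> \<rho> i \<in> Y" for i
    using n0 by (simp add: Z_def Y_def \<rho>_def C_mod)
  have "\<rho> ` Z = Y"
  proof
    show "\<rho> ` Z \<subseteq> Y"
      by (auto simp: Z_iff)
    show "Y \<subseteq> \<rho> ` Z"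
    proof
      fix y
      assume "y \<in> Y"
      then have "y \<in> \<rho> ` {..<n}"
        unfolding surj by (simp add: Y_def)
      then show "y \<in> \<rho> ` Z"
        using \<open>y \<in> Y\<close> by (auto simp: Z_iff)
    qed
  qed
  moreover have "inj_on \<rho> Z"
    using \<rho> by (rule inj_on_subset) (auto simp: Z_def)
  ultimately have "card Z = k + 1"
    using \<open>card Y = k + 1\<close> card_image by metis
  have "card (Y \<union> Z) = 2 * k + 2"
    using \<open>card Y = k + 1\<close> \<open>card Z = k + 1\<close> disj
    by (subst card_Un_disjoint) (auto simp: Y_def Z_def)
  moreover have "Y \<union> Z \<subseteq> {..<n}"
    by (auto simp: Y_def Z_def)
  ultimately have "card ({..<n} - (Y \<union> Z)) = 1"
    using finite_subset[of "Y \<union> Z" "{..<n}"] by (simp add: card_Diff_subset n_def)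
  then obtain z where z: "{..<n} - (Y \<union> Z) = {z}"
    by (rule card_1_singletonE)
  then have "z \<in> {..<n} - (Y \<union> Z)"
    by simp
  then have "z < n" "\<not> C (z + k + 1)"
    by (simp_all add: Z_def)
  have cover: "C i \<or> C (i + k + 1)" if "i mod n \<noteq> z" for i
  proof -
    have "i mod n \<notin> {..<n} - (Y \<union> Z)"
      unfolding z using that by simp
    then have "i mod n \<in> Y \<or> i mod n \<in> Z"
      using n0 by simp
    then have "C (i mod n) \<or> C (i mod n + (k + 1))"
      unfolding Y_def Z_def by auto
    moreover have "C (i mod n + (k + 1)) \<longleftrightarrow> C (i + (k + 1))"
      by (metis C_mod mod_add_left_eq)
    ultimately show ?thesis
      by (simp add: C_mod add.assoc)
  qed
  have shift: "(z + \<delta>) mod n \<noteq> z" if "0 < \<delta>" "\<delta> < n" for \<delta>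
    using that \<open>z < n\<close> mod_neq_if_close[of z "z + \<delta>" n] by simp
  have "C (z + 2 * k + 2 - m)" if "m \<le> k" for m
    using that
  proof (induction m)
    case 0
    have "C (z + k + 1 + k + 1)"
      using cover[of "z + k + 1"] shift[of "k + 1"] \<open>\<not> C (z + k + 1)\<close> by (simp add: n_def add.assoc)
    then show ?case
      by (simp add: mult_2 add_ac)
  next
    case (Suc m)
    define i where "i = z + 2 * k + 2 - m"
    have "C i"
      using Suc by (simp add: i_def)
    then have "\<not> C (i + k + 1)"
      by (rule disj)
    moreover have "(i + k + 1) mod n \<noteq> z"
    proof -
      have "i + k + 1 = n + (z + (k - m))"
        using Suc.prems by (simp add: i_def n_def)
      then have "(i + k + 1) mod n = (z + (k - m)) mod n"
        by (simp only: mod_add_self1)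
      moreover have "0 < k - m" "k - m < n"
        using Suc.prems by (simp_all add: n_def)
      ultimately show ?thesis
        using shift[of "k - m"] by metis
    qed
    ultimately have "C (i + k + 1 + k + 1)"
      using cover by blast
    moreover have "i + k + 1 + k + 1 = n + (z + 2 * k + 2 - Suc m)"
      using Suc.prems by (simp add: i_def n_def)
    ultimately show ?case
      by (metis C_mod mod_add_self1)
  qed
  moreover have "\<exists>m\<le>k. i = z + 2 * k + 2 - m" if "i \<in> {z + k + 1 + 1..z + k + 1 + k + 1}" for i
    using that by (intro exI[of _ "z + 2 * k + 2 - i"]) auto
  ultimately have "C i" if "i \<in> {z + k + 1 + 1..z + k + 1 + k + 1}" for i
    using that by blast
  then show ?thesis
    using that[of "z + k + 1"] unfolding C_def by blast
qed

lemma multitriang_complex_iff: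
  "F \<in> multitriang_complex k (2 * k + 3) \<longleftrightarrow>
     F \<subseteq> relevant_edges k (2 * k + 3) \<and> (\<forall>z. \<exists>i \<in> {z + 1..z + k + 1}. star_edge k i \<notin> F)"
  (is "_ \<longleftrightarrow> ?R")
proof
  assume F: "F \<in> multitriang_complex k (2 * k + 3)"
  have "\<exists>i \<in> {z + 1..z + k + 1}. star_edge k i \<notin> F" for z
  proof (rule ccontr)
    assume none: "\<not> ?thesis"
    define X where "X = star_edge k ` {z + 1..z + k + 1}"
    have cross: "crosses (star_edge k i) (star_edge k j)"
      if "i \<in> {z + 1..z + k + 1}" "j \<in> {z + 1..z + k + 1}" "i < j" for i j
      using that star_edge_crosses_iff[of i j k] by auto
    have neq: "star_edge k i \<noteq> star_edge k j"
      if "i \<in> {z + 1..z + k + 1}" "j \<in> {z + 1..z + k + 1}" "i < j" for i j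
      unfolding star_edge_eq_iff using that by (intro mod_neq_if_close) auto
    have "inj_on (star_edge k) {z + 1..z + k + 1}"
      using neq by (intro linorder_inj_onI') auto
    then have "card X = k + 1"
      by (simp add: X_def card_image)
    moreover have "X \<subseteq> F"
      using none by (auto simp: X_def)
    moreover have "\<forall>e \<in> X. \<forall>f \<in> X. e \<noteq> f \<longrightarrow> crosses e f"
    proof (intro ballI impI)
      fix e f
      assume "e \<in> X" "f \<in> X" "e \<noteq> f"
      then obtain i j where ij: "i \<in> {z + 1..z + k + 1}" "j \<in> {z + 1..z + k + 1}"
        "e = star_edge k i" "f = star_edge k j" "i \<noteq> j"
        unfolding X_def by blast
      then show "crosses e f"
        using cross[of i j] cross[of j i] crosses_sym[of e f] by (cases i j rule: linorder_cases) auto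
    qed
    ultimately show False
      using F unfolding multitriang_complex_def by blast
  qed
  then show ?R
    using F by (auto simp: multitriang_complex_def)
next
  assume R: ?R
  have False
    if X: "X \<subseteq> F" "card X = k + 1" "\<forall>e \<in> X. \<forall>f \<in> X. e \<noteq> f \<longrightarrow> crosses e f" for X
  proof -
    have "X \<subseteq> relevant_edges k (2 * k + 3)"
      using X(1) R by blast
    from crossing_family_contains_arc[OF this X(2)] X(3)
    obtain w where "\<And>i. i \<in> {w + 1..w + k + 1} \<Longrightarrow> star_edge k i \<in> X"
      by blast
    then show False
      using R X(1) by blast
  qed
  then have "\<not> (\<exists>X \<subseteq> F. card X = k + 1 \<and> (\<forall>e \<in> X. \<forall>f \<in> X. e \<noteq> f \<longrightarrow> crosses e f))"
    by blast
  then show "F \<in> multitriang_complex k (2 * k + 3)"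
    using R by (simp add: multitriang_complex_def)
qed

section \<open>Fans whose linear dependences are harmonic\<close>

lemma span_image_iff:
  fixes v :: "'e \<Rightarrow> 'a::real_vector"
  assumes "finite I"
  shows "x \<in> span (v ` I) \<longleftrightarrow> (\<exists>u. x = (\<Sum>e\<in>I. u e *\<^sub>R v e))"
proof
  define S where "S = range (\<lambda>u. \<Sum>e\<in>I. u e *\<^sub>R v e)"
  have "subspace S"
    unfolding subspace_def S_def
  proof (intro conjI ballI allI)
    show "0 \<in> range (\<lambda>u. \<Sum>e\<in>I. u e *\<^sub>R v e)"
      by (rule range_eqI[of _ _ "\<lambda>_. 0"]) simp
  next
    fix x y
    assume "x \<in> range (\<lambda>u. \<Sum>e\<in>I. u e *\<^sub>R v e)" "y \<in> range (\<lambda>u. \<Sum>e\<in>I. u e *\<^sub>R v e)"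
    then obtain a b where "x = (\<Sum>e\<in>I. a e *\<^sub>R v e)" "y = (\<Sum>e\<in>I. b e *\<^sub>R v e)"
      by blast
    then show "x + y \<in> range (\<lambda>u. \<Sum>e\<in>I. u e *\<^sub>R v e)"
      by (intro range_eqI[of _ _ "\<lambda>e. a e + b e"]) (simp add: scaleR_add_left sum.distrib)
  next
    fix t x
    assume "x \<in> range (\<lambda>u. \<Sum>e\<in>I. u e *\<^sub>R v e)"
    then obtain a where "x = (\<Sum>e\<in>I. a e *\<^sub>R v e)"
      by blast
    then show "t *\<^sub>R x \<in> range (\<lambda>u. \<Sum>e\<in>I. u e *\<^sub>R v e)"
      by (intro range_eqI[of _ _ "\<lambda>e. t * a e"]) (simp add: scaleR_sum_right)
  qed
  moreover have "v e \<in> S" if "e \<in> I" for e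
  proof -
    have "v e = (\<Sum>f\<in>I. (if f = e then 1 else 0) *\<^sub>R v f)"
      using that \<open>finite I\<close> by (simp add: if_distrib[of "\<lambda>a. a *\<^sub>R _"] cong: if_cong)
    then show ?thesis
      unfolding S_def by (rule range_eqI[of _ _ "\<lambda>f. if f = e then 1 else 0"])
  qed
  ultimately have "span (v ` I) \<subseteq> S"
    by (intro span_minimal) auto
  then show "\<exists>u. x = (\<Sum>e\<in>I. u e *\<^sub>R v e)" if "x \<in> span (v ` I)"
    using that by (auto simp: S_def)
next
  assume "\<exists>u. x = (\<Sum>e\<in>I. u e *\<^sub>R v e)"
  then obtain u where "x = (\<Sum>e\<in>I. u e *\<^sub>R v e)"
    by blast
  then show "x \<in> span (v ` I)"
    by (simp add: span_sum span_scale span_base)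
qed

lemma coset_eq_iff:
  assumes "subspace U"
  shows "a +o U = b +o U \<longleftrightarrow> a - b \<in> U"
proof
  assume "a +o U = b +o U"
  moreover have "a \<in> a +o U"
    using subspace_0[OF assms] by (auto simp: elt_set_plus_def)
  ultimately obtain u where "u \<in> U" "a = b + u"
    by (auto simp: elt_set_plus_def)
  then show "a - b \<in> U"
    by simp
next
  assume ab: "a - b \<in> U"
  have sub: "x +o U \<subseteq> y +o U" if "x - y \<in> U" for x y
  proof
    fix z
    assume "z \<in> x +o U"
    then obtain w where "w \<in> U" "z = x + w"
      by (auto simp: elt_set_plus_def)
    then have "z = y + ((x - y) + w)" "(x - y) + w \<in> U"
      using subspace_add[OF assms that] by simp_all
    then show "z \<in> y +o U"
      unfolding elt_set_plus_def by blast
  qed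
  have "b - a \<in> U"
    using subspace_neg[OF assms ab] by simp
  then show "a +o U = b +o U"
    using sub ab by blast
qed

lemma coset_eq_self_iff:
  assumes "subspace U"
  shows "a +o U = U \<longleftrightarrow> a \<in> U"
  using coset_eq_iff[OF assms, of a 0] by (simp add: set_zero_plus)

text \<open>
  Combinations of the relevant vectors, with coefficients indexed along the star.
\<close>

definition star_comb :: "nat \<Rightarrow> (nat set \<Rightarrow> 'a::real_vector) \<Rightarrow> (nat \<Rightarrow> real) \<Rightarrow> 'a" where
  "star_comb k v d = (\<Sum>i<2 * k + 3. d i *\<^sub>R v (star_edge k i))"

lemma star_comb_diff: "star_comb k v (\<lambda>i. c i - d i) = star_comb k v c - star_comb k v d"
  by (simp add: star_comb_def scaleR_diff_left sum_subtractf)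

lemma star_comb_cong:
  "(\<And>i. i < 2 * k + 3 \<Longrightarrow> c i = d i) \<Longrightarrow> star_comb k v c = star_comb k v d"
  by (simp add: star_comb_def)

lemma sum_relevant_eq_star_comb:
  assumes "F \<subseteq> relevant_edges k (2 * k + 3)"
  shows "(\<Sum>e\<in>F. c e *\<^sub>R v e)
     = star_comb k v (\<lambda>i. if star_edge k i \<in> F then c (star_edge k i) else 0)"
proof -
  have fin: "finite (relevant_edges k (2 * k + 3))"
    using bij_betw_finite[OF star_edge_bij, of k] by simp
  have "(\<Sum>e\<in>F. c e *\<^sub>R v e) = (\<Sum>e\<in>relevant_edges k (2 * k + 3). if e \<in> F then c e *\<^sub>R v e else 0)"
    using assms fin by (simp add: sum.inter_restrict[symmetric] Int_absorb1)
  also have "\<dots> = (\<Sum>e\<in>relevant_edges k (2 * k + 3). (if e \<in> F then c e else 0) *\<^sub>R v e)"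
    by (intro sum.cong) auto
  also have "\<dots> = star_comb k v (\<lambda>i. if star_edge k i \<in> F then c (star_edge k i) else 0)"
    unfolding star_comb_def by (rule sum.reindex_bij_betw[OF star_edge_bij, symmetric])
  finally show ?thesis .
qed

lemma ex_edge_weights:
  obtains \<omega> where "\<And>i. i < 2 * k + 3 \<Longrightarrow> \<omega> (star_edge k i) = d i"
  using that[of "\<lambda>e. d (the_inv_into {..<2 * k + 3} (star_edge k) e)"]
    bij_betw_imp_inj_on[OF star_edge_bij, of k] by (simp add: the_inv_into_f_f)

text \<open>
  Points of all cones become coefficient vectors on the same index set, so that points of different
  cones can be subtracted.
\<close>

lemma quot_cone_iff:
  assumes U: "subspace U" and F: "F \<subseteq> relevant_edges k (2 * k + 3)"
  shows "A \<in> quot_cone U F (\<lambda>e. v e +o U) \<longleftrightarrow>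
    (\<exists>d. (\<forall>i<2 * k + 3. 0 \<le> d i) \<and> (\<forall>i<2 * k + 3. star_edge k i \<notin> F \<longrightarrow> d i = 0) \<and>
         A = star_comb k v d +o U)" (is "_ \<longleftrightarrow> ?R")
proof -
  have "finite F"
    using bij_betw_finite[OF star_edge_bij, of k] F finite_subset by auto
  then have lincomb: "quot_lincomb U F c (\<lambda>e. v e +o U)
      = star_comb k v (\<lambda>i. if star_edge k i \<in> F then c (star_edge k i) else 0) +o U" for c
    by (simp only: quot_lincomb_coset[OF U] sum_relevant_eq_star_comb[OF F])
  show ?thesis
  proof
    assume "A \<in> quot_cone U F (\<lambda>e. v e +o U)"
    then obtain c where c: "A = quot_lincomb U F c (\<lambda>e. v e +o U)" "\<forall>e\<in>F. 0 \<le> c e"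
      unfolding quot_cone_def by blast
    then show ?R
      unfolding c(1) lincomb
      by (intro exI[of _ "\<lambda>i. if star_edge k i \<in> F then c (star_edge k i) else 0"]) auto
  next
    assume ?R
    then obtain d where d: "\<And>i. i < 2 * k + 3 \<Longrightarrow> 0 \<le> d i"
      "\<And>i. i < 2 * k + 3 \<Longrightarrow> star_edge k i \<notin> F \<Longrightarrow> d i = 0" "A = star_comb k v d +o U"
      by blast
    obtain \<omega> where \<omega>: "\<And>i. i < 2 * k + 3 \<Longrightarrow> \<omega> (star_edge k i) = d i"
      using ex_edge_weights by blast
    have "A = quot_lincomb U F \<omega> (\<lambda>e. v e +o U)"
      unfolding lincomb d(3) by (intro arg_cong[where f = "\<lambda>x. x +o U"] star_comb_cong) (simp add: \<omega> d)
    moreover have "0 \<le> \<omega> e" if "e \<in> F" for e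
    proof -
      have "e \<in> star_edge k ` {..<2 * k + 3}"
        using that F bij_betw_imp_surj_on[OF star_edge_bij, of k] by blast
      then show ?thesis
        using \<omega> d(1) by auto
    qed
    ultimately show "A \<in> quot_cone U F (\<lambda>e. v e +o U)"
      unfolding quot_cone_def by blast
  qed
qed

lemma edges_split:
  "edges n = relevant_edges k n \<union> irrelevant_edges k n"
  "relevant_edges k n \<inter> irrelevant_edges k n = {}"
  by (auto simp: relevant_edges_def irrelevant_edges_def)

lemma sum_edges_split:
  "(\<Sum>e\<in>edges (2 * k + 3). \<omega> e *\<^sub>R v e)
     = star_comb k v (\<lambda>i. \<omega> (star_edge k i)) + (\<Sum>e\<in>irrelevant_edges k (2 * k + 3). \<omega> e *\<^sub>R v e)"
proof -
  have fin: "finite (relevant_edges k (2 * k + 3))" "finite (irrelevant_edges k (2 * k + 3))"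
    using finite_edges[of "2 * k + 3"] by (simp_all add: edges_split(1)[of _ k])
  have "(\<Sum>e\<in>edges (2 * k + 3). \<omega> e *\<^sub>R v e)
      = (\<Sum>e\<in>relevant_edges k (2 * k + 3). \<omega> e *\<^sub>R v e)
        + (\<Sum>e\<in>irrelevant_edges k (2 * k + 3). \<omega> e *\<^sub>R v e)"
    unfolding edges_split(1)[of _ k] by (rule sum.union_disjoint[OF fin edges_split(2)])
  moreover have "(\<Sum>e\<in>relevant_edges k (2 * k + 3). \<omega> e *\<^sub>R v e)
      = star_comb k v (\<lambda>i. \<omega> (star_edge k i))"
    using sum_relevant_eq_star_comb[of "relevant_edges k (2 * k + 3)" k \<omega> v]
    by (simp add: star_edge_relevant)
  ultimately show ?thesis
    by simp
qed

text \<open>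
  The coefficients of the irrelevant edges are moved to the other side of the equation, so a
  dependence in the quotient is the restriction of a dependence among all vectors.
\<close>

lemma star_comb_in_irrelevant_span_iff:
  fixes v :: "nat set \<Rightarrow> 'a::real_vector"
  shows "star_comb k v c \<in> span (v ` irrelevant_edges k (2 * k + 3)) \<longleftrightarrow>
    (\<exists>\<omega>. (\<Sum>e\<in>edges (2 * k + 3). \<omega> e *\<^sub>R v e) = 0 \<and> (\<forall>i<2 * k + 3. \<omega> (star_edge k i) = c i))"
    (is "?L \<longleftrightarrow> ?R")
proof -
  define I where "I = irrelevant_edges k (2 * k + 3)"
  have "finite I"
    using finite_edges[of "2 * k + 3"] by (simp add: I_def edges_split(1)[of _ k])
  have notI: "star_edge k i \<notin> I" for i
    using star_edge_relevant[of k i] edges_split(2)[of k "2 * k + 3"] by (auto simp: I_def)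
  show ?thesis
  proof
    assume ?L
    then obtain u where u: "star_comb k v c = (\<Sum>e\<in>I. u e *\<^sub>R v e)"
      unfolding span_image_iff[OF \<open>finite I\<close>[unfolded I_def]] I_def by blast
    obtain \<omega> where \<omega>: "\<And>i. i < 2 * k + 3 \<Longrightarrow> \<omega> (star_edge k i) = c i"
      using ex_edge_weights by blast
    define \<omega>' where "\<omega>' e = (if e \<in> I then - u e else \<omega> e)" for e
    have \<omega>': "\<omega>' (star_edge k i) = c i" if "i < 2 * k + 3" for i
      using \<omega>[OF that] notI by (simp add: \<omega>'_def)
    have "star_comb k v (\<lambda>i. \<omega>' (star_edge k i)) = star_comb k v c"
      by (rule star_comb_cong) (rule \<omega>')
    moreover have "(\<Sum>e\<in>I. \<omega>' e *\<^sub>R v e) = (\<Sum>e\<in>I. - (u e *\<^sub>R v e))"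
      by (intro sum.cong) (simp_all add: \<omega>'_def)
    ultimately have "(\<Sum>e\<in>edges (2 * k + 3). \<omega>' e *\<^sub>R v e)
        = star_comb k v c + (\<Sum>e\<in>I. - (u e *\<^sub>R v e))"
      unfolding sum_edges_split I_def[symmetric] by simp
    also have "\<dots> = 0"
      by (simp add: u sum_negf)
    finally show ?R
      using \<omega>' by blast
  next
    assume ?R
    then obtain \<omega> where 0: "(\<Sum>e\<in>edges (2 * k + 3). \<omega> e *\<^sub>R v e) = 0"
      and \<omega>: "\<And>i. i < 2 * k + 3 \<Longrightarrow> \<omega> (star_edge k i) = c i"
      by blast
    have "star_comb k v c = star_comb k v (\<lambda>i. \<omega> (star_edge k i))"
      by (rule star_comb_cong) (simp add: \<omega>)
    also have "\<dots> = (\<Sum>e\<in>I. (- \<omega> e) *\<^sub>R v e)"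
      using 0 unfolding sum_edges_split I_def[symmetric]
      by (simp add: sum_negf eq_neg_iff_add_eq_0)
    finally show ?L
      unfolding span_image_iff[OF \<open>finite I\<close>[unfolded I_def]] I_def
      by (intro exI[of _ "\<lambda>e. - \<omega> e"])
  qed
qed

text \<open>
  Two coefficient vectors represent the same point of the quotient if they differ by a harmonic
  function.  Dimension, independence, intersections and covering therefore reduce to statements about
  harmonic functions: interpolation at the three indices outside a fixed face, the vanishing of
  two-sided functions (twice), and the optimal function below a given coefficient vector.
\<close>

lemma realizes_complete_fan_if_harmonic:
  fixes v :: "nat set \<Rightarrow> 'a::real_vector"
  assumes kernel: "\<And>c. star_comb k v c \<in> span (v ` irrelevant_edges k (2 * k + 3)) \<longleftrightarrow>
        (\<exists>p. \<forall>i<2 * k + 3. c i = harmonic (2 * k + 3) p i)"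
  shows "realizes_complete_fan k (2 * k + 3) v"
proof -
  define n where "n = 2 * k + 3"
  have n0: "0 < n"
    by (simp add: n_def)
  define W where "W = span (v ` edges n)"
  define U where "U = span (v ` irrelevant_edges k n)"
  define \<Delta> where "\<Delta> = multitriang_complex k n"
  have U: "subspace U"
    by (simp add: U_def)
  have in_U: "star_comb k v c \<in> U \<longleftrightarrow> (\<exists>p. \<forall>i<n. c i = harmonic n p i)" for c
    using kernel by (simp add: U_def n_def)
  have in_W: "star_comb k v c \<in> W" for c
    unfolding star_comb_def W_def n_def
    using star_edge_relevant[of k] by (intro span_sum span_scale span_base) (auto simp: relevant_edges_def)
  have \<Delta>_sub: "F \<subseteq> relevant_edges k (2 * k + 3)" if "F \<in> \<Delta>" for F
    using that by (simp add: \<Delta>_def n_def multitriang_complex_iff)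
  have \<Delta>_window: "\<exists>i \<in> {z + 1..z + k + 1}. star_edge k i \<notin> F" if "F \<in> \<Delta>" for F z
    using that by (simp add: \<Delta>_def n_def multitriang_complex_iff)
  have star_mod: "star_edge k (i mod n) = star_edge k i" for i
    by (simp add: n_def star_edge_mod)
  have repr: "\<exists>c. w +o U = star_comb k v c +o U" if "w \<in> W" for w
  proof -
    obtain \<omega> where "w = (\<Sum>e\<in>edges n. \<omega> e *\<^sub>R v e)"
      using \<open>w \<in> W\<close> unfolding W_def n_def span_image_iff[OF finite_edges] by blast
    then have "w - star_comb k v (\<lambda>i. \<omega> (star_edge k i)) = (\<Sum>e\<in>irrelevant_edges k n. \<omega> e *\<^sub>R v e)"
      using sum_edges_split[of \<omega> v] by (simp add: n_def)
    also have "\<dots> \<in> U"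
      unfolding U_def by (intro span_sum span_scale span_base) auto
    finally show ?thesis
      using coset_eq_iff[OF U] by blast
  qed
  have dim: "has_quot_dim W U (k * (n - 2 * k - 1))"
  proof -
    \<comment> \<open>The basis comes from the facet that omits \<open>0, k + 1, k + 2\<close>; \<open>f\<close> enumerates its indices and \<open>g\<close>
      is the inverse.\<close>
    define I where "I = {..<n} - {0, k + 1, k + 2}"
    define f where "f m = (if m < k then m + 1 else m + 3)" for m
    define g where "g i = (if i \<le> k then i - 1 else i - 3)" for i :: nat
    define b where "b m = v (star_edge k (f m)) +o U" for m
    have comb: "quot_lincomb U {..<2 * k} c b = star_comb k v (\<lambda>i. if i \<in> I then c (g i) else 0) +o U"
      for c
    proof -
      have "quot_lincomb U {..<2 * k} c b = (\<Sum>m<2 * k. c m *\<^sub>R v (star_edge k (f m))) +o U"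
        unfolding b_def by (rule quot_lincomb_coset[OF U]) simp
      also have "(\<Sum>m<2 * k. c m *\<^sub>R v (star_edge k (f m))) = (\<Sum>i\<in>I. c (g i) *\<^sub>R v (star_edge k i))"
        by (rule sum.reindex_bij_witness[of _ g f]) (auto simp: f_def g_def I_def n_def)
      also have "\<dots> = (\<Sum>i<n. if i \<in> I then c (g i) *\<^sub>R v (star_edge k i) else 0)"
        by (subst sum.inter_restrict[symmetric]) (auto simp: I_def intro: sum.cong)
      also have "\<dots> = star_comb k v (\<lambda>i. if i \<in> I then c (g i) else 0)"
        unfolding star_comb_def n_def by (intro sum.cong) auto
      finally show ?thesis .
    qed
    have "b m \<in> quot_space W U" if "m < 2 * k" for m
      unfolding b_def quot_space_def W_def n_def using star_edge_relevant[of k]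
      by (intro imageI span_base) (auto simp: relevant_edges_def)
    moreover have "quot_independent U {..<2 * k} b"
      unfolding quot_independent_def comb coset_eq_self_iff[OF U] in_U
    proof (intro allI impI ballI)
      fix c m
      assume "\<exists>p. \<forall>i<n. (if i \<in> I then c (g i) else 0) = harmonic n p i" and m: "m \<in> {..<2 * k}"
      then obtain p where p: "\<And>i. i < n \<Longrightarrow> harmonic n p i = (if i \<in> I then c (g i) else 0)"
        by metis
      have "p = 0"
        by (rule harmonic_eq_0_if_three_zeros[OF n_def]; subst p) (simp_all add: I_def n_def)
      moreover have "f m < n" "f m \<in> I" "g (f m) = m"
        using m by (auto simp: f_def g_def I_def n_def)
      ultimately show "c m = 0"
        using p[of "f m"] by simp
    qed
    moreover have "\<exists>c. A = quot_lincomb U {..<2 * k} c b" if "A \<in> quot_space W U" for A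
    proof -
      obtain w where w: "w \<in> W" "A = w +o U"
        using \<open>A \<in> quot_space W U\<close> by (auto simp: quot_space_def)
      obtain d where d: "A = star_comb k v d +o U"
        using repr[OF w(1)] w(2) by blast
      obtain p where p: "harmonic n p 0 = d 0" "harmonic n p (k + 1) = d (k + 1)"
        "harmonic n p (k + 2) = d (k + 2)"
        by (rule harmonic_interpolation[OF n_def])
      define c where "c m = d (f m) - harmonic n p (f m)" for m
      have "d i - (if i \<in> I then c (g i) else 0) = harmonic n p i" if "i < n" for i
      proof (cases "i \<in> I")
        case True
        then have "f (g i) = i"
          by (auto simp: f_def g_def I_def n_def)
        then show ?thesis
          using True by (simp add: c_def)
      next
        case False
        then have "i \<in> {0, k + 1, k + 2}"
          using that by (simp add: I_def)
        then show ?thesis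
          using False p by auto
      qed
      then have "A = quot_lincomb U {..<2 * k} c b"
        unfolding d comb coset_eq_iff[OF U] star_comb_diff[symmetric] in_U by blast
      then show ?thesis
        by blast
    qed
    ultimately have "has_quot_dim W U (2 * k)"
      unfolding has_quot_dim_def by (intro exI[of _ b]) simp
    moreover have "k * (n - 2 * k - 1) = 2 * k"
      by (simp add: n_def)
    ultimately show ?thesis
      by (simp only:)
  qed
  have independent: "quot_independent U F (\<lambda>e. v e +o U)" if F: "F \<in> \<Delta>" for F
    unfolding quot_independent_def
  proof (intro allI impI ballI)
    fix c e
    assume "quot_lincomb U F c (\<lambda>e. v e +o U) = U" "e \<in> F"
    define d where "d i = (if star_edge k i \<in> F then c (star_edge k i) else 0)" for i
    have "finite F"
      using bij_betw_finite[OF star_edge_bij, of k] \<Delta>_sub[OF F] finite_subset by auto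
    then have "star_comb k v d +o U = U"
      using \<open>quot_lincomb U F c (\<lambda>e. v e +o U) = U\<close>
      unfolding d_def by (simp only: quot_lincomb_coset[OF U] sum_relevant_eq_star_comb[OF \<Delta>_sub[OF F]])
    then obtain p where p: "\<And>i. i < n \<Longrightarrow> d i = harmonic n p i"
      unfolding coset_eq_self_iff[OF U] in_U by blast
    have zero: "harmonic n p i = 0" if "star_edge k i \<notin> F" for i
      using p[of "i mod n"] that n0 by (simp add: d_def star_mod harmonic_mod)
    have "\<exists>i \<in> {z + 1..z + k + 1}. harmonic n p i = 0" for z
      using \<Delta>_window[OF F] zero by blast
    then have "p = 0"
      by (intro harmonic_eq_0_if_two_sided[OF n_def]) (metis order_refl)+
    moreover have "e \<in> star_edge k ` {..<n}"
      unfolding n_def bij_betw_imp_surj_on[OF star_edge_bij, of k] using \<open>e \<in> F\<close> \<Delta>_sub[OF F] by blast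
    then obtain i where "i < n" "e = star_edge k i"
      by blast
    ultimately show "c e = 0"
      using p[of i] \<open>e \<in> F\<close> by (simp add: d_def)
  qed
  have inter: "quot_cone U F (\<lambda>e. v e +o U) \<inter> quot_cone U G (\<lambda>e. v e +o U)
      = quot_cone U (F \<inter> G) (\<lambda>e. v e +o U)" if F: "F \<in> \<Delta>" and G: "G \<in> \<Delta>" for F G
  proof -
    have FG: "F \<inter> G \<subseteq> relevant_edges k (2 * k + 3)"
      using \<Delta>_sub[OF F] by blast
    note iff = quot_cone_iff[OF U \<Delta>_sub[OF F], of _ v] quot_cone_iff[OF U \<Delta>_sub[OF G], of _ v]
      quot_cone_iff[OF U FG, of _ v]
    show ?thesis
    proof (intro subset_antisym subsetI)
      fix A
      assume "A \<in> quot_cone U (F \<inter> G) (\<lambda>e. v e +o U)"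
      then show "A \<in> quot_cone U F (\<lambda>e. v e +o U) \<inter> quot_cone U G (\<lambda>e. v e +o U)"
        unfolding Int_iff iff by blast
    next
      fix A
      assume "A \<in> quot_cone U F (\<lambda>e. v e +o U) \<inter> quot_cone U G (\<lambda>e. v e +o U)"
      then obtain c d where c: "\<And>i. i < n \<Longrightarrow> 0 \<le> c i" "\<And>i. i < n \<Longrightarrow> star_edge k i \<notin> F \<Longrightarrow> c i = 0"
          "A = star_comb k v c +o U"
        and d: "\<And>i. i < n \<Longrightarrow> 0 \<le> d i" "\<And>i. i < n \<Longrightarrow> star_edge k i \<notin> G \<Longrightarrow> d i = 0"
          "A = star_comb k v d +o U"
        unfolding Int_iff iff n_def[symmetric] by blast
      have "star_comb k v c - star_comb k v d \<in> U"
        using c(3) d(3) coset_eq_iff[OF U] by metis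
      then obtain p where p: "\<And>i. i < n \<Longrightarrow> c i - d i = harmonic n p i"
        unfolding star_comb_diff[symmetric] in_U by blast
      have p_mod: "harmonic n p i = c (i mod n) - d (i mod n)" for i
        using p[of "i mod n"] n0 by (simp add: harmonic_mod)
      have "harmonic n p i \<le> 0" if "star_edge k i \<notin> F" for i
        using c(2)[of "i mod n"] d(1)[of "i mod n"] that n0 by (simp add: p_mod star_mod)
      moreover have "0 \<le> harmonic n p i" if "star_edge k i \<notin> G" for i
        using d(2)[of "i mod n"] c(1)[of "i mod n"] that n0 by (simp add: p_mod star_mod)
      ultimately have "p = 0"
        using \<Delta>_window[OF F] \<Delta>_window[OF G]
        by (intro harmonic_eq_0_if_two_sided[OF n_def]) blast+
      then have "c i = d i" if "i < n" for i
        using p[OF that] by simp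
      then show "A \<in> quot_cone U (F \<inter> G) (\<lambda>e. v e +o U)"
        unfolding iff n_def[symmetric] using c d by (intro exI[of _ c]) auto
    qed
  qed
  have cover: "(\<Union>F \<in> \<Delta>. quot_cone U F (\<lambda>e. v e +o U)) = quot_space W U"
  proof (intro subset_antisym subsetI)
    fix A
    assume "A \<in> (\<Union>F \<in> \<Delta>. quot_cone U F (\<lambda>e. v e +o U))"
    then obtain F where F: "F \<in> \<Delta>" "A \<in> quot_cone U F (\<lambda>e. v e +o U)"
      by blast
    then obtain d where "A = star_comb k v d +o U"
      using quot_cone_iff[OF U \<Delta>_sub[OF F(1)]] by blast
    then show "A \<in> quot_space W U"
      using in_W by (simp add: quot_space_def)
  next
    fix A
    assume "A \<in> quot_space W U"
    then obtain w where w: "w \<in> W" "A = w +o U"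
      by (auto simp: quot_space_def)
    obtain c where c: "A = star_comb k v c +o U"
      using repr[OF w(1)] w(2) by blast
    obtain p where le: "\<And>i. i < n \<Longrightarrow> harmonic n p i \<le> c i"
      and tight: "\<And>z. \<exists>i \<in> {z + 1..z + k + 1}. harmonic n p i = c (i mod n)"
      by (rule harmonic_optimum[OF n_def, of c]) (rule that)
    define F where "F = star_edge k ` {i. i < n \<and> harmonic n p i \<noteq> c i}"
    have F_iff: "star_edge k i \<in> F \<longleftrightarrow> harmonic n p i \<noteq> c (i mod n)" for i
    proof
      assume "star_edge k i \<in> F"
      then obtain j where "j < n" "harmonic n p j \<noteq> c j" "star_edge k i = star_edge k j"
        by (auto simp: F_def)
      moreover from this have "i mod n = j"
        by (simp add: star_edge_eq_iff n_def)
      ultimately show "harmonic n p i \<noteq> c (i mod n)"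
        using harmonic_mod[OF n0, of p i] by simp
    next
      assume "harmonic n p i \<noteq> c (i mod n)"
      then have "i mod n \<in> {i. i < n \<and> harmonic n p i \<noteq> c i}"
        using n0 by (simp add: harmonic_mod)
      then show "star_edge k i \<in> F"
        unfolding F_def using star_mod by (metis imageI)
    qed
    have "F \<subseteq> relevant_edges k (2 * k + 3)"
      using star_edge_relevant by (auto simp: F_def)
    moreover have "\<forall>z. \<exists>i \<in> {z + 1..z + k + 1}. star_edge k i \<notin> F"
      using tight by (simp add: F_iff)
    ultimately have F: "F \<in> \<Delta>"
      by (simp add: \<Delta>_def n_def multitriang_complex_iff)
    define d where "d i = c i - harmonic n p i" for i
    have "star_comb k v c - star_comb k v d \<in> U"
      unfolding star_comb_diff[symmetric] in_U by (intro exI[of _ p]) (simp add: d_def)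
    then have "A = star_comb k v d +o U"
      unfolding c by (simp add: coset_eq_iff[OF U])
    moreover have "0 \<le> d i" if "i < n" for i
      using le[OF that] by (simp add: d_def)
    moreover have "d i = 0" if "i < n" "star_edge k i \<notin> F" for i
      using that by (simp add: F_iff d_def)
    ultimately have "A \<in> quot_cone U F (\<lambda>e. v e +o U)"
      unfolding quot_cone_iff[OF U \<Delta>_sub[OF F]] n_def[symmetric] by blast
    then show "A \<in> (\<Union>F \<in> \<Delta>. quot_cone U F (\<lambda>e. v e +o U))"
      using F by blast
  qed
  show ?thesis
    unfolding realizes_complete_fan_def Let_def n_def[symmetric] W_def[symmetric] U_def[symmetric]
      \<Delta>_def[symmetric]
    using dim independent inter cover by blast
qed

section \<open>Stresses of regular polygons\<close>

definition circle_point :: "real \<times> real \<Rightarrow> real \<Rightarrow> real \<Rightarrow> real \<times> real" where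
  "circle_point c r \<alpha> = c + r *\<^sub>R (cos \<alpha>, sin \<alpha>)"

lemma regular_polygon_vertices:
  assumes "regular_polygon n q" "0 < n"
  obtains c r \<theta> s where "0 < r" "s = 1 \<or> s = -1"
    "\<And>i. q (i mod n + 1) = circle_point c r (\<theta> + s * (2 * pi * real i / real n))"
proof -
  obtain c r \<theta> s where r: "0 < r" and s: "s \<in> {1, -1}" and
    q: "\<And>i. i \<in> {1..n} \<Longrightarrow> q i = c + r *\<^sub>R (cos (\<theta> + s * 2 * pi * real i / real n),
                                       sin (\<theta> + s * 2 * pi * real i / real n))"
    using assms(1) unfolding regular_polygon_def by blast
  have "q (i mod n + 1) = circle_point c r (\<theta> + s * 2 * pi / n + s * (2 * pi * real i / real n))" for i
  proof -
    define \<alpha> where "\<alpha> = \<theta> + s * 2 * pi * real (i mod n + 1) / real n"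
    have "real i = real (i mod n) + real n * real (i div n)"
      by (metis add.commute mult_div_mod_eq of_nat_add of_nat_mult)
    then have "\<theta> + s * 2 * pi / n + s * (2 * pi * real i / real n)
        = \<alpha> + s * (2 * real (i div n) * pi)"
      using assms(2) by (simp add: \<alpha>_def field_simps)
    moreover have "cos (\<alpha> + s * (2 * real (i div n) * pi)) = cos \<alpha>"
        "sin (\<alpha> + s * (2 * real (i div n) * pi)) = sin \<alpha>"
      using s by (auto simp: cos_add sin_add)
    moreover have "i mod n + 1 \<in> {1..n}"
      using assms(2) by (simp add: Suc_leI)
    ultimately show ?thesis
      using q[of "i mod n + 1"] by (simp only: circle_point_def \<alpha>_def)
  qed
  with r s show ?thesis
    by (intro that[of r s c "\<theta> + s * 2 * pi / n"]) auto
qed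

lemma wedge_scaleR: "wedge (a *\<^sub>R u) (b *\<^sub>R v) = a * b * wedge u v"
  by (simp add: wedge_def algebra_simps)

text \<open>
  The chord between the points at angles \<open>a\<close> and \<open>x\<close> is normal to the direction \<open>(a + x) / 2\<close>, with
  signed length \<open>2 r sin ((x - a) / 2)\<close>.
\<close>

lemma wedge_circle_point_diff:
  "wedge (circle_point c r b - circle_point c r a) (circle_point c r g - circle_point c r a)
     = 4 * r\<^sup>2 * sin ((b - a) / 2) * sin ((g - a) / 2) * sin ((g - b) / 2)"
proof -
  have chord: "circle_point c r x - circle_point c r a
      = (2 * r * sin ((x - a) / 2)) *\<^sub>R (- sin ((x + a) / 2), cos ((x + a) / 2))" for x
  proof -
    have "cos x - cos a = - (2 * sin ((x - a) / 2) * sin ((x + a) / 2))"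
      using sin_minus[of "(x - a) / 2"] cos_diff_cos[of x a] by (simp add: minus_divide_left)
    moreover have "sin x - sin a = 2 * sin ((x - a) / 2) * cos ((x + a) / 2)"
      using sin_diff_sin[of x a] by simp
    ultimately show ?thesis
      by (simp add: circle_point_def flip: right_diff_distrib)
  qed
  have "wedge (- sin ((b + a) / 2), cos ((b + a) / 2)) (- sin ((g + a) / 2), cos ((g + a) / 2))
      = sin ((g + a) / 2 - (b + a) / 2)"
    by (simp add: wedge_def sin_diff)
  also have "(g + a) / 2 - (b + a) / 2 = (g - b) / 2"
    by (simp add: field_simps)
  finally show ?thesis
    unfolding chord wedge_scaleR by (simp add: power2_eq_square)
qed

lemma sin_rotation_neq_0:
  assumes "s = 1 \<or> s = (-1 :: real)" "0 < \<bar>x\<bar>" "\<bar>x\<bar> < real n"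
  shows "sin (s * (pi * x / real n)) \<noteq> 0"
proof -
  have n: "0 < real n"
    using assms by linarith
  have "0 < sin (pi * \<bar>x\<bar> / real n)"
    using assms n by (intro sin_gt_zero) (simp_all add: divide_simps)
  moreover have "s * (pi * x / real n) = pi * \<bar>x\<bar> / real n \<or> s * (pi * x / real n) = - (pi * \<bar>x\<bar> / real n)"
    using assms(1) by (auto simp: abs_if)
  ultimately show ?thesis
    by (metis less_irrefl neg_equal_0_iff_equal sin_minus)
qed

lemma vertex_bij:
  fixes n i :: nat
  assumes "0 < n"
  shows "bij_betw (\<lambda>m. (i + m) mod n + 1) {..<n} {1..n}"
proof -
  have "(i + a) mod n + 1 \<noteq> (i + b) mod n + 1" if "a < b" "b < n" for a b
    using that mod_neq_if_close[of "i + a" "i + b" n] by simp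
  then have "inj_on (\<lambda>m. (i + m) mod n + 1) {..<n}"
    by (intro linorder_inj_onI') auto
  moreover have "(\<lambda>m. (i + m) mod n + 1) ` {..<n} \<subseteq> {1..n}"
    using assms by (auto simp: Suc_le_eq)
  ultimately show ?thesis
    unfolding bij_betw_def by (intro conjI card_subset_eq) (simp_all add: card_image)
qed

text \<open>
  The chord of central angle \<open>2 \<delta>\<close> has its normal in direction \<open>\<alpha> + \<delta>\<close>, and all such chords have the
  same distance from the centre.  So its equation is harmonic in the index of the chord, and \<open>\<Phi>\<close> is
  composed of the translation to the centre, a rotation, possibly a reflection, and scalings of the
  coordinates.
\<close>

lemma circle_line_form:
  assumes r: "r \<noteq> 0" and s: "s = 1 \<or> s = -1" and \<delta>: "sin \<delta> \<noteq> 0" "cos \<delta> \<noteq> 0"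
  obtains \<Phi> where "surj \<Phi>"
    "\<And>q i j m p. q i = circle_point c r (\<theta> + s * (2 * pi * real m / real n)) \<Longrightarrow>
        q j = circle_point c r (\<theta> + s * (2 * pi * real m / real n) + 2 * \<delta>) \<Longrightarrow>
        line_form q i j p = harmonic n (\<Phi> p) m"
proof -
  define K where "K = - 2 * r * sin \<delta>"
  define \<eta> where "\<eta> = \<theta> + \<delta>"
  define A where "A p = fst p - snd (snd p) * fst c" for p :: "real \<times> real \<times> real"
  define B where "B p = fst (snd p) - snd (snd p) * snd c" for p :: "real \<times> real \<times> real"
  define \<Phi> where "\<Phi> p = (K * (A p * cos \<eta> + B p * sin \<eta>),
      K * s * (B p * cos \<eta> - A p * sin \<eta>), - (K * r * cos \<delta> * snd (snd p)))" for p
  have K: "K \<noteq> 0"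
    using r \<delta> by (simp add: K_def)
  have ss: "s * s = 1"
    using s by auto
  show ?thesis
  proof (rule that[of \<Phi>])
    show "surj \<Phi>"
    proof (rule surjI)
      fix p :: "real \<times> real \<times> real"
      \<comment> \<open>The rotation is inverted by its transpose and the reflection by itself.\<close>
      define z where "z = - snd (snd p) / (K * r * cos \<delta>)"
      define a where "a = (fst p * cos \<eta> - s * fst (snd p) * sin \<eta>) / K"
      define b where "b = (fst p * sin \<eta> + s * fst (snd p) * cos \<eta>) / K"
      have Ka: "K * a = fst p * cos \<eta> - s * fst (snd p) * sin \<eta>"
        and Kb: "K * b = fst p * sin \<eta> + s * fst (snd p) * cos \<eta>"
        using K by (simp_all add: a_def b_def)
      have one: "cos \<eta> * cos \<eta> + sin \<eta> * sin \<eta> = 1"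
        by (simp flip: power2_eq_square)
      have "K * (a * cos \<eta> + b * sin \<eta>) = (K * a) * cos \<eta> + (K * b) * sin \<eta>"
        by (simp add: algebra_simps)
      also have "\<dots> = fst p * (cos \<eta> * cos \<eta> + sin \<eta> * sin \<eta>)"
        unfolding Ka Kb by (simp only: algebra_simps)
      finally have 1: "K * (a * cos \<eta> + b * sin \<eta>) = fst p"
        unfolding one by simp
      have "K * s * (b * cos \<eta> - a * sin \<eta>) = s * ((K * b) * cos \<eta> - (K * a) * sin \<eta>)"
        by (simp add: algebra_simps)
      also have "\<dots> = (s * s) * fst (snd p) * (cos \<eta> * cos \<eta> + sin \<eta> * sin \<eta>)"
        unfolding Ka Kb by (simp only: algebra_simps)
      finally have 2: "K * s * (b * cos \<eta> - a * sin \<eta>) = fst (snd p)"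
        unfolding one ss by simp
      have AB: "A (a + z * fst c, b + z * snd c, z) = a" "B (a + z * fst c, b + z * snd c, z) = b"
        by (simp_all add: A_def B_def)
      show "\<Phi> (a + z * fst c, b + z * snd c, z) = p"
        unfolding \<Phi>_def AB 1 2 using K r \<delta> by (simp add: z_def prod_eq_iff)
    qed
    fix q :: "'b \<Rightarrow> real \<times> real" and i j m and p :: "real \<times> real \<times> real"
    define x where "x = 2 * pi * real m / real n"
    define \<alpha> where "\<alpha> = \<theta> + s * x"
    assume "q i = circle_point c r (\<theta> + s * (2 * pi * real m / real n))"
      "q j = circle_point c r (\<theta> + s * (2 * pi * real m / real n) + 2 * \<delta>)"
    then have q: "q i = circle_point c r \<alpha>" "q j = circle_point c r (\<alpha> + 2 * \<delta>)"
      by (simp_all add: \<alpha>_def x_def)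
    have dy: "sin \<alpha> - sin (\<alpha> + 2 * \<delta>) = - 2 * sin \<delta> * cos (\<alpha> + \<delta>)"
      using sin_diff_sin[of \<alpha> "\<alpha> + 2 * \<delta>"] by (simp add: algebra_simps add_divide_distrib)
    have dx: "cos (\<alpha> + 2 * \<delta>) - cos \<alpha> = - 2 * sin \<delta> * sin (\<alpha> + \<delta>)"
      using cos_diff_cos[of "\<alpha> + 2 * \<delta>" \<alpha>] by (simp add: algebra_simps add_divide_distrib)
    have w: "cos \<alpha> * sin (\<alpha> + 2 * \<delta>) - sin \<alpha> * cos (\<alpha> + 2 * \<delta>) = 2 * sin \<delta> * cos \<delta>"
      using sin_diff[of "\<alpha> + 2 * \<delta>" \<alpha>] unfolding add_diff_cancel_left' sin_double
      by (simp add: mult_ac)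
    have "line_form q i j p
        = A p * (r * (sin \<alpha> - sin (\<alpha> + 2 * \<delta>))) + B p * (r * (cos (\<alpha> + 2 * \<delta>) - cos \<alpha>))
          + snd (snd p) * (r * r * (cos \<alpha> * sin (\<alpha> + 2 * \<delta>) - sin \<alpha> * cos (\<alpha> + 2 * \<delta>)))"
      by (simp add: line_form_def q circle_point_def wedge_def A_def B_def algebra_simps)
    also have "\<dots> = K * (A p * cos (\<alpha> + \<delta>) + B p * sin (\<alpha> + \<delta>)) - K * r * cos \<delta> * snd (snd p)"
      unfolding dy dx w by (simp add: K_def algebra_simps)
    also have "\<alpha> + \<delta> = \<eta> + s * x"
      by (simp add: \<alpha>_def \<eta>_def)
    also have "cos (\<eta> + s * x) = cos \<eta> * cos x - s * sin \<eta> * sin x"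
      using s by (auto simp: cos_add)
    also have "sin (\<eta> + s * x) = sin \<eta> * cos x + s * cos \<eta> * sin x"
      using s by (auto simp: sin_add)
    finally show "line_form q i j p = harmonic n (\<Phi> p) m"
      by (simp add: harmonic_def \<Phi>_def x_def algebra_simps)
  qed
qed

text \<open>
  The denominators of the stress formula depend only on index differences, hence take one value \<open>D\<close>
  on the star.  Conversely a harmonic function fixes \<open>p\<close>, and the formula defines a stress on all
  edges; it does not depend on the order of the end points because numerator and denominator both
  change sign, the latter having \<open>2k + 1\<close> factors.
\<close>

lemma regular_polygon_stress_iff:
  assumes k: "1 \<le> k" and n: "n = 2 * k + 3" and reg: "regular_polygon n q"
  shows "(\<exists>\<omega>. is_stress (2 * k) {1..n} q \<omega> \<and> (\<forall>i<n. \<omega> (star_edge k i) = c i))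
     \<longleftrightarrow> (\<exists>p. \<forall>i<n. c i = harmonic n p i)" (is "?L \<longleftrightarrow> ?R")
proof -
  have n0: "0 < n"
    using n by simp
  obtain c0 r \<theta> s where r: "0 < r" and s: "s = 1 \<or> s = -1" and
    q: "\<And>i. q (i mod n + 1) = circle_point c0 r (\<theta> + s * (2 * pi * real i / real n))"
    by (rule regular_polygon_vertices[OF reg n0]) (rule that)
  define \<sigma> where "\<sigma> x = sin (s * (pi * x / real n))" for x
  have \<sigma>: "\<sigma> x \<noteq> 0" if "0 < \<bar>x\<bar>" "\<bar>x\<bar> < real n" for x
    unfolding \<sigma>_def using sin_rotation_neq_0[OF s that] .
  have orient: "orient q (i mod n + 1) (j mod n + 1) (l mod n + 1)
      = 4 * r\<^sup>2 * \<sigma> (real j - real i) * \<sigma> (real l - real i) * \<sigma> (real l - real j)" for i j l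
  proof -
    have half: "(\<theta> + s * (2 * pi * x / real n) - (\<theta> + s * (2 * pi * y / real n))) / 2
        = s * (pi * (x - y) / real n)" for x y
      using n0 by (simp add: field_simps)
    show ?thesis
      unfolding orient_def q wedge_circle_point_diff half \<sigma>_def ..
  qed
  have gp: "general_position {1..n} q"
    unfolding general_position_def
  proof (intro ballI impI)
    fix i j l
    assume ijl: "i \<in> {1..n}" "j \<in> {1..n}" "l \<in> {1..n}" and ne: "i \<noteq> j \<and> i \<noteq> l \<and> j \<noteq> l"
    have pred: "(m - 1) mod n + 1 = m" "real (m - 1) = real m - 1" if "m \<in> {1..n}" for m
      using that by auto
    have "orient q i j l
        = 4 * r\<^sup>2 * \<sigma> (real j - real i) * \<sigma> (real l - real i) * \<sigma> (real l - real j)"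
      using orient[of "i - 1" "j - 1" "l - 1"] by (simp only: pred[OF ijl(1)] pred[OF ijl(2)] pred[OF ijl(3)]) simp
    moreover have "\<sigma> (real x - real y) \<noteq> 0" if "x \<in> {1..n}" "y \<in> {1..n}" "x \<noteq> y" for x y
      using that by (intro \<sigma>) auto
    ultimately show "orient q i j l \<noteq> 0"
      using r ijl ne by simp
  qed
  define \<delta> where "\<delta> = s * (pi * real (k + 1) / real n)"
  have sin: "sin \<delta> \<noteq> 0"
    using \<sigma>[of "real (k + 1)"] n by (simp add: \<sigma>_def \<delta>_def)
  have cos: "cos \<delta> \<noteq> 0"
  proof -
    have "pi * real (k + 1) / real n < pi / 2"
      using n by (simp add: field_simps)
    then have "0 < cos (pi * real (k + 1) / real n)"
      by (intro cos_gt_zero) (use n0 in auto)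
    then show ?thesis
      using s by (auto simp: \<delta>_def)
  qed
  have "r \<noteq> 0"
    using r by simp
  obtain \<Phi> where \<Phi>: "surj \<Phi>"
    "\<And>q i j m p. q i = circle_point c0 r (\<theta> + s * (2 * pi * real m / real n)) \<Longrightarrow>
        q j = circle_point c0 r (\<theta> + s * (2 * pi * real m / real n) + 2 * \<delta>) \<Longrightarrow>
        line_form q (i :: nat) j p = harmonic n (\<Phi> p) m"
    by (rule circle_line_form[OF \<open>r \<noteq> 0\<close> s sin cos, of c0 \<theta> n]) (rule that)
  define u where "u i = i mod n + 1" for i
  define v where "v i = (i + k + 1) mod n + 1" for i
  have uv: "star_edge k i = {u i, v i}" "u i \<in> {1..n}" "v i \<in> {1..n}" "u i \<noteq> v i" for i
    using n0 mod_neq_if_close[of i "i + k + 1" n]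
    by (auto simp: star_edge_def u_def v_def n Suc_le_eq)
  have line: "line_form q (u i) (v i) p = harmonic n (\<Phi> p) i" for i p
  proof (rule \<Phi>(2))
    show "q (u i) = circle_point c0 r (\<theta> + s * (2 * pi * real i / real n))"
      unfolding u_def by (rule q)
    have "\<theta> + s * (2 * pi * real (i + k + 1) / real n)
        = \<theta> + s * (2 * pi * real i / real n) + 2 * \<delta>"
      using n0 by (simp add: \<delta>_def field_simps)
    then show "q (v i) = circle_point c0 r (\<theta> + s * (2 * pi * real i / real n) + 2 * \<delta>)"
      unfolding v_def using q[of "i + k + 1"] by (simp only:)
  qed
  define D where "D = (\<Prod>m\<in>{..<n} - {0, k + 1}.
      4 * r\<^sup>2 * \<sigma> (real (k + 1)) * \<sigma> (real m) * \<sigma> (real m - real (k + 1)))"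
  have "D \<noteq> 0"
  proof -
    have "\<sigma> (real (k + 1)) \<noteq> 0"
      using n by (intro \<sigma>) auto
    moreover have "\<sigma> (real m) \<noteq> 0" "\<sigma> (real m - real (k + 1)) \<noteq> 0" if "m \<in> {..<n} - {0, k + 1}" for m
      using n that by (intro \<sigma>; auto)+
    ultimately show ?thesis
      unfolding D_def using r by (simp del: of_nat_add of_nat_Suc)
  qed
  have prod: "(\<Prod>l\<in>{1..n} - {u i, v i}. orient q (u i) (v i) l) = D" for i
  proof -
    have bij: "bij_betw (\<lambda>m. (i + m) mod n + 1) ({..<n} - {0, k + 1}) ({1..n} - {u i, v i})"
    proof -
      have "(\<lambda>m. (i + m) mod n + 1) ` {0, k + 1} = {u i, v i}"
        by (simp add: u_def v_def add.assoc)
      moreover have "{0, k + 1} \<subseteq> {..<n}"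
        using n by simp
      moreover have "inj_on (\<lambda>m. (i + m) mod n + 1) {..<n}" "(\<lambda>m. (i + m) mod n + 1) ` {..<n} = {1..n}"
        using vertex_bij[OF n0, of i] by (simp_all only: bij_betw_def)
      ultimately have "(\<lambda>m. (i + m) mod n + 1) ` ({..<n} - {0, k + 1}) = {1..n} - {u i, v i}"
        by (metis inj_on_image_set_diff Diff_subset)
      moreover have "inj_on (\<lambda>m. (i + m) mod n + 1) ({..<n} - {0, k + 1})"
        using \<open>inj_on (\<lambda>m. (i + m) mod n + 1) {..<n}\<close> by (rule inj_on_subset) simp
      ultimately show ?thesis
        unfolding bij_betw_def by blast
    qed
    have "orient q (u i) (v i) ((i + m) mod n + 1)
        = 4 * r\<^sup>2 * \<sigma> (real (k + 1)) * \<sigma> (real m) * \<sigma> (real m - real (k + 1))" for m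
    proof -
      have "real (i + k + 1) - real i = real (k + 1)" "real (i + m) - real i = real m"
          "real (i + m) - real (i + k + 1) = real m - real (k + 1)"
        by simp_all
      then show ?thesis
        unfolding u_def v_def orient by (simp only:)
    qed
    then show ?thesis
      unfolding D_def prod.reindex_bij_betw[OF bij, symmetric] by (simp only:)
  qed
  have V: "finite {1..n}" "card {1..n} = 2 * k + 3" "even (2 * k)" "0 < 2 * k"
    using n k by auto
  note stress_iff = stress_iff_line_form[OF V gp]
  show ?thesis
  proof
    assume ?L
    then obtain \<omega> where st: "is_stress (2 * k) {1..n} q \<omega>" and \<omega>: "\<And>i. i < n \<Longrightarrow> \<omega> (star_edge k i) = c i"
      by blast
    from st obtain p where p: "\<And>i j. i \<in> {1..n} \<Longrightarrow> j \<in> {1..n} \<Longrightarrow> i \<noteq> j \<Longrightarrow>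
        \<omega> {i, j} * (\<Prod>l\<in>{1..n} - {i, j}. orient q i j l) = line_form q i j p"
      unfolding stress_iff by blast
    have "c i = harmonic n ((1 / D) *\<^sub>R \<Phi> p) i" if "i < n" for i
    proof -
      have "c i * D = harmonic n (\<Phi> p) i"
        using p[OF uv(2,3,4), of i] \<omega>[OF that] unfolding prod line uv(1) by simp
      then show ?thesis
        using \<open>D \<noteq> 0\<close> by (simp add: harmonic_scaleR field_simps)
    qed
    then show ?R
      by blast
  next
    assume ?R
    then obtain p' where p': "\<And>i. i < n \<Longrightarrow> c i = harmonic n p' i"
      by blast
    obtain p where p: "D *\<^sub>R p' = \<Phi> p"
      using \<Phi>(1) by (rule surjE)
    define \<Psi> where "\<Psi> i j = (\<Prod>l\<in>{1..n} - {i, j}. orient q i j l)" for i j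
    have \<Psi>: "\<Psi> i j \<noteq> 0" if "i \<in> {1..n}" "j \<in> {1..n}" "i \<noteq> j" for i j
      using gp that by (auto simp: \<Psi>_def general_position_def)
    have anti: "\<Psi> j i = - \<Psi> i j" if "i \<in> {1..n}" "j \<in> {1..n}" "i \<noteq> j" for i j
    proof -
      have "card ({1..n} - {i, j}) = 2 * k + 1"
        using V that by (subst card_Diff_subset) auto
      then have "odd (card ({1..n} - {i, j}))"
        by simp
      then show ?thesis
        by (simp add: \<Psi>_def orient_swap'[of q j i] prod_uminus insert_commute)
    qed
    define \<omega> where "\<omega> e = line_form q (Min e) (Max e) p / \<Psi> (Min e) (Max e)" for e
    have \<omega>: "\<omega> {i, j} * \<Psi> i j = line_form q i j p" if "i \<in> {1..n}" "j \<in> {1..n}" "i \<noteq> j" for i j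
    proof (cases "i < j")
      case True
      then have "Min {i, j} = i" "Max {i, j} = j"
        by auto
      then show ?thesis
        using \<Psi>[OF that] by (simp add: \<omega>_def)
    next
      case False
      then have "Min {i, j} = j" "Max {i, j} = i"
        by auto
      then show ?thesis
        using \<Psi>[OF that] anti[OF that] by (simp add: \<omega>_def line_form_antisym[of q j i])
    qed
    then have "is_stress (2 * k) {1..n} q \<omega>"
      unfolding stress_iff \<Psi>_def by blast
    moreover have "\<omega> (star_edge k i) = c i" if "i < n" for i
    proof -
      have "\<omega> (star_edge k i) * D = D * harmonic n p' i"
        using \<omega>[OF uv(2,3,4), of i]
        unfolding \<Psi>_def prod line uv(1) p[symmetric] harmonic_scaleR .
      then show ?thesis
        using p'[OF that] \<open>D \<noteq> 0\<close> by simp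
    qed
    ultimately show ?L
      by blast
  qed
qed

section \<open>Regular polygons are in convex position\<close>

lemma face_of_convex_hull_maximizer:
  fixes u :: "'a::euclidean_space"
  assumes "finite S" "T \<subseteq> S" and T: "\<And>x. x \<in> T \<Longrightarrow> u \<bullet> x = b"
    and less: "\<And>x. x \<in> S - T \<Longrightarrow> u \<bullet> x < b"
  shows "convex hull T face_of convex hull S"
proof (rule face_of_convex_hulls[OF assms(1,2)])
  have "affine hull T \<subseteq> {x. u \<bullet> x = b}"
    using T by (intro hull_minimal affine_hyperplane) auto
  moreover have "convex hull (S - T) \<subseteq> {x. u \<bullet> x < b}"
    using less by (intro hull_minimal convex_halfspace_lt) auto
  ultimately show "affine hull T \<inter> convex hull (S - T) = {}"
    by fastforce
qed

text \<open>
  A vertex maximizes the linear functional in its own direction from the centre (\<open>\<epsilon> = 0\<close>), and a side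
  maximizes the one in the direction of its midpoint (\<open>\<epsilon> = \<pi> / n\<close>).
\<close>

lemma regular_polygon_convex_position:
  assumes reg: "regular_polygon n q" and n: "3 \<le> n"
  shows "convex_position n q"
proof -
  have n0: "0 < n"
    using n by simp
  obtain c r \<theta> s where r: "0 < r" and s: "s = 1 \<or> s = -1" and
    q: "\<And>i. q (i mod n + 1) = circle_point c r (\<theta> + s * (2 * pi * real i / real n))"
    by (rule regular_polygon_vertices[OF reg n0]) (rule that)
  define u where "u i \<epsilon> = (cos (\<theta> + s * (2 * pi * real i / real n) + s * \<epsilon>),
      sin (\<theta> + s * (2 * pi * real i / real n) + s * \<epsilon>))" for i :: nat and \<epsilon>
  have inner: "u i \<epsilon> \<bullet> q ((i + m) mod n + 1) = u i \<epsilon> \<bullet> c + r * cos (2 * pi * real m / real n - \<epsilon>)"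
    for i m \<epsilon>
  proof -
    define \<alpha> where "\<alpha> = \<theta> + s * (2 * pi * real (i + m) / real n)"
    define \<beta> where "\<beta> = \<theta> + s * (2 * pi * real i / real n) + s * \<epsilon>"
    have "\<alpha> - \<beta> = s * (2 * pi * real m / real n - \<epsilon>)"
      using n0 by (simp add: \<alpha>_def \<beta>_def field_simps)
    then have "cos (\<alpha> - \<beta>) = cos (2 * pi * real m / real n - \<epsilon>)"
      using s by (metis cos_minus mult_1 mult_minus1)
    moreover have "(cos \<beta>, sin \<beta>) \<bullet> circle_point c r \<alpha> = (cos \<beta>, sin \<beta>) \<bullet> c + r * cos (\<alpha> - \<beta>)"
      by (simp add: circle_point_def inner_add_right inner_prod_def cos_diff algebra_simps)
    moreover have "u i \<epsilon> = (cos \<beta>, sin \<beta>)"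
      unfolding u_def \<beta>_def ..
    moreover have "q ((i + m) mod n + 1) = circle_point c r \<alpha>"
      unfolding q \<alpha>_def ..
    ultimately show ?thesis
      by simp
  qed
  have sin_pos: "0 < sin (pi * real m / real n)" if "0 < m" "m < n" for m
    using that by (intro sin_gt_zero) (simp_all add: divide_simps)
  have vertex: "\<exists>u b. u \<bullet> q v = b \<and> (\<forall>w\<in>{1..n} - {v}. u \<bullet> q w < b)" if v: "v \<in> {1..n}" for v
  proof (intro exI conjI ballI)
    define i where "i = v - 1"
    have v_eq: "v = (i + 0) mod n + 1"
      using v by (auto simp: i_def)
    show "u i 0 \<bullet> q v = u i 0 \<bullet> c + r"
      unfolding v_eq inner by simp
    fix w
    assume w: "w \<in> {1..n} - {v}"
    then have "w \<in> (\<lambda>m. (i + m) mod n + 1) ` {..<n}"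
      using bij_betw_imp_surj_on[OF vertex_bij[OF n0, of i]] by blast
    then obtain m where m: "m < n" "w = (i + m) mod n + 1"
      by blast
    have "m \<noteq> 0"
      using w v_eq m by (intro notI) simp
    then have "0 < sin (pi * real m / real n)"
      using sin_pos m by simp
    moreover have "cos (2 * pi * real m / real n) = 1 - 2 * (sin (pi * real m / real n))\<^sup>2"
      using cos_double_sin[of "pi * real m / real n"] by (simp add: mult.assoc)
    ultimately have "cos (2 * pi * real m / real n - 0) < 1"
      by simp
    then have "r * cos (2 * pi * real m / real n - 0) < r * 1"
      using r by (rule mult_strict_left_mono)
    then show "u i 0 \<bullet> q w < u i 0 \<bullet> c + r"
      unfolding m(2) inner by simp
  qed
  have side: "\<exists>u b. u \<bullet> q v = b \<and> u \<bullet> q v' = b \<and> (\<forall>w\<in>{1..n} - {v, v'}. u \<bullet> q w < b)"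
    if v: "v \<in> {1..n}" and v': "v' = (if v = n then 1 else v + 1)" for v v'
  proof (intro exI conjI ballI)
    define i where "i = v - 1"
    define \<epsilon> where "\<epsilon> = pi / real n"
    have v_eq: "v = (i + 0) mod n + 1"
      using v by (auto simp: i_def)
    have v'_eq: "v' = (i + 1) mod n + 1"
      using v v' by (auto simp: i_def)
    have "2 * pi * real 1 / real n - \<epsilon> = \<epsilon>"
      by (simp add: \<epsilon>_def)
    then show "u i \<epsilon> \<bullet> q v' = u i \<epsilon> \<bullet> c + r * cos \<epsilon>"
      unfolding v'_eq inner by simp
    show "u i \<epsilon> \<bullet> q v = u i \<epsilon> \<bullet> c + r * cos \<epsilon>"
      unfolding v_eq inner by simp
    fix w
    assume w: "w \<in> {1..n} - {v, v'}"
    then have "w \<in> (\<lambda>m. (i + m) mod n + 1) ` {..<n}"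
      using bij_betw_imp_surj_on[OF vertex_bij[OF n0, of i]] by blast
    then obtain m where m: "m < n" "w = (i + m) mod n + 1"
      by blast
    have "m \<noteq> 0" "m \<noteq> 1"
      using w v_eq v'_eq m by (intro notI; simp)+
    then have "0 < sin (pi * real m / real n) * sin (pi * real (m - 1) / real n)"
      using m by (intro mult_pos_pos sin_pos) auto
    moreover have "cos \<epsilon> - cos (2 * pi * real m / real n - \<epsilon>)
        = 2 * (sin (pi * real m / real n) * sin (pi * real (m - 1) / real n))"
    proof -
      have "(\<epsilon> + (2 * pi * real m / real n - \<epsilon>)) / 2 = pi * real m / real n"
        by simp
      moreover have "(2 * pi * real m / real n - \<epsilon> - \<epsilon>) / 2 = pi * real (m - 1) / real n"
        using \<open>m \<noteq> 0\<close> n0 by (simp add: \<epsilon>_def of_nat_diff field_simps)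
      ultimately show ?thesis
        using cos_diff_cos[of \<epsilon> "2 * pi * real m / real n - \<epsilon>"] by (simp only:)
    qed
    ultimately have "cos (2 * pi * real m / real n - \<epsilon>) < cos \<epsilon>"
      by linarith
    then have "r * cos (2 * pi * real m / real n - \<epsilon>) < r * cos \<epsilon>"
      using r by (rule mult_strict_left_mono)
    then show "u i \<epsilon> \<bullet> q w < u i \<epsilon> \<bullet> c + r * cos \<epsilon>"
      unfolding m(2) inner by simp
  qed
  have inj: "inj_on q {1..n}"
  proof (rule inj_onI, rule ccontr)
    fix v w
    assume vw: "v \<in> {1..n}" "w \<in> {1..n}" "q v = q w" "v \<noteq> w"
    obtain u b where "u \<bullet> q v = b" "\<forall>w\<in>{1..n} - {v}. u \<bullet> q w < b"
      using vertex[OF vw(1)] by blast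
    then have "u \<bullet> q w < u \<bullet> q v"
      using vw by blast
    then show False
      using vw(3) by simp
  qed
  have face: "convex hull (q ` T) face_of convex hull (q ` {1..n})"
    if T: "T \<subseteq> {1..n}" "\<forall>w\<in>T. u \<bullet> q w = b" "\<forall>w\<in>{1..n} - T. u \<bullet> q w < b" for T u b
  proof (rule face_of_convex_hull_maximizer)
    show "finite (q ` {1..n})" "q ` T \<subseteq> q ` {1..n}"
      using T(1) by auto
    show "u \<bullet> x = b" if "x \<in> q ` T" for x
      using that T(2) by blast
    show "u \<bullet> x < b" if "x \<in> q ` {1..n} - q ` T" for x
      using that T(3) by blast
  qed
  have "q v extreme_point_of convex hull (q ` {1..n})" if v: "v \<in> {1..n}" for v
  proof -
    obtain u b where "u \<bullet> q v = b" "\<forall>w\<in>{1..n} - {v}. u \<bullet> q w < b"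
      using vertex[OF v] by blast
    then have "convex hull (q ` {v}) face_of convex hull (q ` {1..n})"
      using v by (intro face) simp_all
    then show ?thesis
      by (simp add: face_of_singleton)
  qed
  then have extreme: "{p. p extreme_point_of (convex hull (q ` {1..n}))} = q ` {1..n}"
    using extreme_point_of_convex_hull by blast
  have sides: "closed_segment (q v) (q v') edge_of convex hull (q ` {1..n})"
    if v: "v \<in> {1..n}" and v': "v' = (if v = n then 1 else v + 1)" for v v'
  proof -
    obtain u b where ub: "u \<bullet> q v = b" "u \<bullet> q v' = b" "\<forall>w\<in>{1..n} - {v, v'}. u \<bullet> q w < b"
      using side[OF v v'] by blast
    have v'_in: "v' \<in> {1..n}" "v' \<noteq> v"
      using v v' n by (auto split: if_splits)
    have "convex hull (q ` {v, v'}) face_of convex hull (q ` {1..n})"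
      using v v'_in ub by (intro face) simp_all
    moreover have "q v \<noteq> q v'"
      using inj_onD[OF inj _ v v'_in(1)] v'_in(2) by blast
    ultimately show ?thesis
      by (simp add: edge_of_def segment_convex_hull aff_dim_convex_hull aff_dim_2)
  qed
  show ?thesis
    unfolding convex_position_def using inj extreme sides by (intro conjI ballI) simp_all
qed

section \<open>The realization\<close>

theorem corollary3p17:
  fixes k :: nat
  assumes "1 \<le> k"
  shows "(\<exists>q. convex_position (2 * k + 3) q \<and>
              realizes_complete_fan k (2 * k + 3) (cofactor_row (2 * k) q)) \<and>
         (\<forall>q. regular_polygon (2 * k + 3) q \<longrightarrow>
              convex_position (2 * k + 3) q \<and>
              realizes_complete_fan k (2 * k + 3) (cofactor_row (2 * k) q))"
proof -
  have regular: "convex_position (2 * k + 3) q \<and>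
      realizes_complete_fan k (2 * k + 3) (cofactor_row (2 * k) q)"
    if reg: "regular_polygon (2 * k + 3) q" for q
  proof
    show "convex_position (2 * k + 3) q"
      using reg by (rule regular_polygon_convex_position) simp
    show "realizes_complete_fan k (2 * k + 3) (cofactor_row (2 * k) q)"
      by (rule realizes_complete_fan_if_harmonic)
        (simp only: star_comb_in_irrelevant_span_iff row_combination_eq_0_iff even_mult_iff
          even_numeral simp_thms regular_polygon_stress_iff[OF assms refl reg])
  qed
  have "regular_polygon (2 * k + 3)
      (\<lambda>i. (cos (2 * pi * real i / real (2 * k + 3)), sin (2 * pi * real i / real (2 * k + 3))))"
    unfolding regular_polygon_def
    by (intro exI[of _ "(0, 0)"] exI[of _ 1] exI[of _ 0]) simp
  then show ?thesis
    using regular by blast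
qed

end
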